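(* For all integers $m\geq 3$ we have $\mathcal{N}(3,m)\leq 2^m-2$ and, in particular, $\mathcal{N}(3,3)=5$, $\mathcal{N}(3,4)\leq 14$, and $\mathcal{N}(3,5)\leq 30$. Furthermore, $\mathcal{N}'(3,m)=\mathcal{N}(3,m)$ for all integers $m\geq 3$.
   Context: For $a=(a_1,\ldots,a_n)\in\mathbb{R}^n$ write $x^a:=x_1^{a_1}\cdots x_n^{a_n}$; a monomial term is $cx^a$ with $c\in\mathbb{R}\setminus\{0\}$. Exponents are arbitrary real vectors. The positive orthant is $\mathbb{R}^n_+:=\{x\in\mathbb{R}^n \mid x_i>0 \text{ for all } i\}$. An $n$-variate $m$-nomial is a finite real linear combination of such $x^a$ with exactly $m$ monomial terms (i.e. $m$ distinct exponent vectors with nonzero coefficients). A $k\times n$ fewnomial system of type $(m_1,\ldots,m_k)$, with all $m_i\geq 1$, is $F=(f_1,\ldots,f_k)$ where $f_i$ is an $n$-variate $m_i$-nomial. An arc is a point or a homeomorphic image of the unit circle or of an (open, closed, or half-open) unit interval. A real root $\zeta$ of $F$ is isolated iff the only arc of real roots of $F$ containing $\zeta$ is $\zeta$ itself; it is non-degenerate iff the Jacobian of $F$, evaluated at $\zeta$, has full rank. For $m_1,\ldots,m_n\in\mathbb{N}$, $\mathcal{N}(m_1,\ldots,m_n)$ (resp. $\mathcal{N}'(m_1,\ldots,m_n)$) denotes the maximal number of isolated (resp. non-degenerate) roots an $n\times n$ fewnomial system of type $(m_1,\ldots,m_n)$ can have in the positive orthant. *)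

theory Defs
  imports "HOL-Analysis.Analysis" "HOL-Library.Poly_Mapping" "HOL-Library.Extended_Nat"
begin

definition pos_orthant :: "(real ^ 'n) set" where
  "pos_orthant = {x. \<forall>i. 0 < x $ i}"

definition mono_val :: "real ^ 'n \<Rightarrow> real ^ 'n \<Rightarrow> real" where
  "mono_val a x = (\<Prod>i\<in>UNIV. (x $ i) powr (a $ i))"

text \<open>
  A real linear combination of monomials with real exponent vectors is the finitely supported map
  sending each exponent vector to its coefficient; its monomial terms correspond to the elements
  of \<^const>\<open>Poly_Mapping.keys\<close>.  Evaluation is meaningful on \<^const>\<open>pos_orthant\<close> only.
\<close>

type_synonym 'n fewnomial = "(real ^ 'n) \<Rightarrow>\<^sub>0 real"

definition eval_fewnomial :: "'n::finite fewnomial \<Rightarrow> real ^ 'n \<Rightarrow> real" where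
  "eval_fewnomial f x = (\<Sum>a\<in>Poly_Mapping.keys f. Poly_Mapping.lookup f a * mono_val a x)"

definition is_nomial :: "nat \<Rightarrow> 'n::finite fewnomial \<Rightarrow> bool" where
  "is_nomial m f \<longleftrightarrow> card (Poly_Mapping.keys f) = m"

text \<open>
  A system of \<open>k\<close> fewnomials in \<open>n\<close> variables is a family indexed by a finite type \<open>'k\<close>,
  the variables being indexed by a finite type \<open>'n\<close>.
\<close>

definition has_type :: "('k::finite \<Rightarrow> 'n::finite fewnomial) \<Rightarrow> nat ^ 'k \<Rightarrow> bool" where
  "has_type F m \<longleftrightarrow> (\<forall>i. 1 \<le> m $ i \<and> is_nomial (m $ i) (F i))"

definition eval_system :: "('k::finite \<Rightarrow> 'n::finite fewnomial) \<Rightarrow> real ^ 'n \<Rightarrow> real ^ 'k" where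
  "eval_system F x = (\<chi> i. eval_fewnomial (F i) x)"

definition pos_roots :: "('k::finite \<Rightarrow> 'n::finite fewnomial) \<Rightarrow> (real ^ 'n) set" where
  "pos_roots F = {x \<in> pos_orthant. eval_system F x = 0}"

definition is_arc :: "(real ^ 'n) set \<Rightarrow> bool" where
  "is_arc S \<longleftrightarrow>
     (\<exists>p. S = {p}) \<or>
     S homeomorphic (sphere 0 1 :: complex set) \<or>
     S homeomorphic {0<..<1::real} \<or>
     S homeomorphic {0..1::real} \<or>
     S homeomorphic {0..<1::real} \<or>
     S homeomorphic {0<..1::real}"

text \<open>
  The arcs are taken inside the positive orthant, where monomials with real exponents are defined.
  For a root in this open set, admitting arcs that leave it (when the exponents allow evaluation
  elsewhere) would make no difference: such an arc contains a nontrivial subarc through the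
  root that stays inside.
\<close>

definition isolated_root :: "('k::finite \<Rightarrow> 'n::finite fewnomial) \<Rightarrow> real ^ 'n \<Rightarrow> bool" where
  "isolated_root F z \<longleftrightarrow>
     z \<in> pos_roots F \<and> (\<forall>S. is_arc S \<and> S \<subseteq> pos_roots F \<and> z \<in> S \<longrightarrow> S = {z})"

definition nondegenerate_root :: "('k::finite \<Rightarrow> 'n::finite fewnomial) \<Rightarrow> real ^ 'n \<Rightarrow> bool" where
  "nondegenerate_root F z \<longleftrightarrow>
     z \<in> pos_roots F \<and>
     rank (jacobian (eval_system F) (at z)) = min CARD('k) CARD('n)"

definition num_elems :: "'a set \<Rightarrow> enat" where
  "num_elems S = (if finite S then enat (card S) else \<infinity>)"

text \<open>
  The maximal numbers of roots are suprema in \<^typ>\<open>enat\<close>, so that an unbounded number of roots, or a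
  system with infinitely many, gives \<open>\<infinity>\<close>; a finite supremum over a nonempty set is attained.
\<close>

definition max_isolated :: "nat ^ 'n::finite \<Rightarrow> enat" where
  "max_isolated m =
     (SUP F \<in> {F :: 'n \<Rightarrow> 'n fewnomial. has_type F m}. num_elems {z. isolated_root F z})"

definition max_nondegenerate :: "nat ^ 'n::finite \<Rightarrow> enat" where
  "max_nondegenerate m =
     (SUP F \<in> {F :: 'n \<Rightarrow> 'n fewnomial. has_type F m}. num_elems {z. nondegenerate_root F z})"

end

theory Submission
  imports Defs "HOL-Computational_Algebra.Polynomial"
begin

text \<open>
Let the first equation have exponents \<open>a\<^sub>0, a\<^sub>1, a\<^sub>2\<close> that are affinely independent.  Unless its
coefficients all have the same sign (and it has no positive root), one coefficient has the sign
opposite to the two others.  Dividing by that term and passing to logarithmic coordinates, which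
turn a monomial change of variables into an affine map of the plane, brings the equation into
the form \<open>u + v = 1\<close>.  Its zero set is therefore a curve parametrised by \<open>u \<in> (0, 1)\<close>, on which an
\<open>m\<close>-nomial becomes \<open>\<Sum> c\<^sub>i u\<^sup>\<alpha> (1 - u)\<^sup>\<beta>\<close> with \<open>m\<close> terms (\<open>eval_on_curve\<close>).  If such a sum vanishes
identically, the whole curve consists of roots and none of them is isolated; otherwise the
isolated roots are among its finitely many zeros.

The zeros are counted by Rolle's theorem.  Consider more generally \<open>m\<close> terms \<open>p\<^sub>i(u) u\<^sup>\<alpha> (1 - u)\<^sup>\<beta>\<close>
with polynomials of degree less than \<open>e\<close>.  After division by the powers in one term, \<open>e\<close>
differentiations remove this term, and raise the degree bound of the others to \<open>2 e\<close>.
Summing \<open>1 + 2 + 4 + \<dots>\<close> gives fewer than \<open>2\<^sup>m - 1\<close> zeros (\<open>fewer_zeros_beta_sum\<close>).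

For \<open>m = 3\<close> this gives six zeros, one too many.  Divide by a term such that the two others have
coefficients of the same sign, and assume that their exponent vectors are linearly independent.
The two summands of the derivative carry linear factors, and can
cancel only where these have opposite signs.  If this happens on an interval, the quotient of the
summands is defined there and its derivative has a cubic numerator, so the derivative has at most
four zeros and the function at most five.  Otherwise the region consists of two outer intervals,
and an elementary monotonicity argument shows that the cubic has at most one zero there; this
leaves at most four zeros.  For proportional exponent vectors the derivative factors, and there are
at most four zeros, too (\<open>fewer_zeros_three_beta_terms\<close>).  That five is attained is shown by the
system \<open>x\<^sup>6 + 44/31 y\<^sup>3 = y\<close>, \<open>y\<^sup>6 + 44/31 x\<^sup>3 = x\<close>, by following the sign of the second equation along
the curve of the first.

If \<open>a\<^sub>0, a\<^sub>1, a\<^sub>2\<close> are collinear, the zero set of the first equation in logarithmic coordinates consists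
of at most two parallel lines, on each of which the second equation is an exponential sum with \<open>m\<close>
terms and has at most \<open>m - 1\<close> isolated zeros.  The bound \<open>2 (m - 1)\<close> is below the others.

A nondegenerate root is isolated.  Conversely, for each system there is one of the same type
with at least as many nondegenerate roots as the given one has isolated roots
(\<open>nondegenerate_at_least_isolated\<close>).  In the collinear case a product of two univariate polynomials
with \<open>2\<close> and \<open>m - 1\<close> simple positive roots will do.  Otherwise change one coefficient of the second
equation by a small amount: this replaces \<open>R = 0\<close> by \<open>R = \<epsilon>\<close> for a function \<open>R\<close> on \<open>(0, 1)\<close>.  Each zero of
\<open>R\<close> has two one-sided neighbourhoods, and \<open>R\<close> has a constant sign on each.  At least half of
them share one sign, and for \<open>\<epsilon>\<close> of this sign each of these contains a solution of \<open>R = \<epsilon>\<close>.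
All but finitely many \<open>\<epsilon>\<close> are regular values.
\<close>

section \<open>Counting zeros with Rolle's theorem\<close>

text \<open>
Vanishing identically is admitted, so that the predicate passes from a derivative to the function
itself: where the derivative is identically zero, the function is constant.  The strict bound
gives the zero function the bound \<open>0\<close>, at which the inductions below start.
\<close>

definition fewer_zeros :: "(real \<Rightarrow> real) \<Rightarrow> real set \<Rightarrow> nat \<Rightarrow> bool" where
  "fewer_zeros f I n \<longleftrightarrow>
     (\<forall>x\<in>I. f x = 0) \<or> (finite {x\<in>I. f x = 0} \<and> card {x\<in>I. f x = 0} < n)"

lemma fewer_zeros_mono:
  assumes "fewer_zeros f I n" "n \<le> n'"
  shows "fewer_zeros f I n'"
  using assms unfolding fewer_zeros_def by auto

lemma fewer_zeros_cong_zeros: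
  assumes "fewer_zeros g I n" "\<And>x. x \<in> I \<Longrightarrow> f x = 0 \<longleftrightarrow> g x = 0"
  shows "fewer_zeros f I n"
proof -
  have "{x\<in>I. f x = 0} = {x\<in>I. g x = 0}" using assms(2) by auto
  then show ?thesis using assms unfolding fewer_zeros_def by auto
qed

text \<open>
The zeros are added from left to right; the critical point between the last two is new because
the ones found before lie to the left of the last zero but one.
\<close>

lemma rolle_chain:
  fixes f :: "real \<Rightarrow> real"
  assumes I: "is_interval I"
    and f': "\<And>x. x \<in> I \<Longrightarrow> (f has_real_derivative f' x) (at x)"
    and X: "finite X" "card X = Suc k" "X \<subseteq> {x\<in>I. f x = 0}"
  shows "\<exists>Y. finite Y \<and> card Y = k \<and> Y \<subseteq> {x\<in>I. f' x = 0} \<and> (\<forall>y\<in>Y. y < Max X)"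
  using X
proof (induction k arbitrary: X)
  case 0
  then show ?case by (intro exI[of _ "{}"]) auto
next
  case (Suc k)
  define M where "M = Max X"
  define X' where "X' = X - {M}"
  have "X \<noteq> {}" using Suc.prems by auto
  then have M: "M \<in> X" unfolding M_def using Suc.prems by auto
  then have X': "finite X'" "card X' = Suc k" "X' \<subseteq> {x\<in>I. f x = 0}"
    using Suc.prems by (auto simp: X'_def)
  from Suc.IH[OF this] obtain Y where
    Y: "finite Y" "card Y = k" "Y \<subseteq> {x\<in>I. f' x = 0}" "\<forall>y\<in>Y. y < Max X'" by blast
  define M' where "M' = Max X'"
  have "X' \<noteq> {}" using X' by auto
  then have M': "M' \<in> X'" unfolding M'_def using X' by auto
  then have "M' < M" using Suc.prems by (auto simp: X'_def M_def order_less_le)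
  have between: "x \<in> I" if "M' \<le> x" "x \<le> M" for x
    using I M M' Suc.prems that unfolding is_interval_1 X'_def by blast
  have "\<exists>\<xi>. M' < \<xi> \<and> \<xi> < M \<and> DERIV f \<xi> :> 0"
  proof (rule Rolle)
    have "f M' = 0" "f M = 0" using subsetD[OF X'(3) M'] subsetD[OF Suc.prems(3) M] by auto
    then show "f M' = f M" by simp
    show "continuous_on {M'..M} f"
      by (meson DERIV_continuous_on atLeastAtMost_iff between f' has_field_derivative_at_within)
  qed (use \<open>M' < M\<close> f' between in \<open>auto simp: real_differentiable_def\<close>, meson less_eq_real_def)
  then obtain \<xi> where \<xi>: "M' < \<xi>" "\<xi> < M" "DERIV f \<xi> :> 0" by blast
  then have "\<xi> \<in> I" "f' \<xi> = 0" using between f' DERIV_unique by (meson less_eq_real_def)+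
  moreover have "\<xi> \<notin> Y" using Y(4) \<xi>(1) unfolding M'_def by fastforce
  ultimately show ?case using Y \<xi> unfolding M'_def M_def
    by (intro exI[of _ "insert \<xi> Y"]) (fastforce simp: M'_def M_def)
qed

text \<open>
The version to use where the derivative is known to have finitely many zeros and finiteness
is wanted for the function.
\<close>

lemma finite_zeros_Rolle:
  fixes f :: "real \<Rightarrow> real"
  assumes I: "is_interval I"
    and f': "\<And>x. x \<in> I \<Longrightarrow> (f has_real_derivative f' x) (at x)"
    and fin: "finite {x\<in>I. f' x = 0}" "card {x\<in>I. f' x = 0} < n"
  shows "finite {x\<in>I. f x = 0} \<and> card {x\<in>I. f x = 0} < Suc n"
proof (rule ccontr)
  assume "\<not> ?thesis"
  then obtain X where X: "finite X" "card X = Suc n" "X \<subseteq> {x\<in>I. f x = 0}"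
    by (metis (no_types, lifting) infinite_arbitrarily_large not_less obtain_subset_with_card_n)
  obtain Y where "finite Y" "card Y = n" "Y \<subseteq> {x\<in>I. f' x = 0}"
    using rolle_chain[OF I f' X] by blast
  then show False using fin by (metis card_mono not_less)
qed

lemma fewer_zeros_Rolle:
  fixes f :: "real \<Rightarrow> real"
  assumes I: "is_interval I"
    and f': "\<And>x. x \<in> I \<Longrightarrow> (f has_real_derivative f' x) (at x)"
    and n: "fewer_zeros f' I n"
  shows "fewer_zeros f I (Suc n)"
proof (cases "\<forall>x\<in>I. f' x = 0")
  case True
  have "\<exists>c. \<forall>x\<in>I. f x = c"
  proof (rule has_field_derivative_zero_constant)
    show "convex I" using I is_interval_convex by blast
  next
    fix x assume "x \<in> I"
    then show "(f has_field_derivative 0) (at x within I)"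
      using True f' has_field_derivative_at_within by metis
  qed
  then obtain c where "\<forall>x\<in>I. f x = c" by blast
  then show ?thesis
    by (cases "c = 0") (auto simp: fewer_zeros_def intro!: disjI2 cong: conj_cong)
next
  case False
  then have fin: "finite {x\<in>I. f' x = 0}" "card {x\<in>I. f' x = 0} < n"
    using n unfolding fewer_zeros_def by auto
  then show ?thesis
    using finite_zeros_Rolle[OF I f'] unfolding fewer_zeros_def by blast
qed

lemma fewer_zeros_mult:
  assumes "fewer_zeros f I (Suc m)" "fewer_zeros g I (Suc n)"
  shows "fewer_zeros (\<lambda>x. f x * g x) I (Suc (m + n))"
proof -
  consider "\<forall>x\<in>I. f x * g x = 0"
    | "finite {x\<in>I. f x = 0}" "card {x\<in>I. f x = 0} \<le> m" "finite {x\<in>I. g x = 0}" "card {x\<in>I. g x = 0} \<le> n"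
    using assms unfolding fewer_zeros_def by fastforce
  then show ?thesis
  proof cases
    case 2
    have "{x\<in>I. f x * g x = 0} = {x\<in>I. f x = 0} \<union> {x\<in>I. g x = 0}" by auto
    then show ?thesis unfolding fewer_zeros_def
      using 2 card_Un_le[of "{x\<in>I. f x = 0}" "{x\<in>I. g x = 0}"] by auto
  qed (simp add: fewer_zeros_def)
qed

lemma fewer_zeros_poly:
  fixes p :: "real poly"
  assumes "\<forall>i\<ge>n. coeff p i = 0"
  shows "fewer_zeros (poly p) I n"
proof (cases "p = 0")
  case False
  then have "finite {x. poly p x = 0}" "card {x. poly p x = 0} \<le> degree p"
    by (simp_all add: poly_roots_finite card_poly_roots_bound)
  moreover have "{x\<in>I. poly p x = 0} \<subseteq> {x. poly p x = 0}" by auto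
  moreover have "degree p < n" using False assms
    by (meson leading_coeff_0_iff not_le_imp_less)
  ultimately show ?thesis unfolding fewer_zeros_def
    by (meson card_mono finite_subset le_less_trans)
qed (simp add: fewer_zeros_def)

text \<open>
Dividing by one exponential makes its term constant, and differentiating removes it.  This is
Descartes' rule for \<open>x = exp t\<close>.  Frequencies may coincide: this happens when distinct
monomials are restricted to a line.
\<close>

lemma fewer_zeros_exp_sum:
  assumes "finite K"
  shows "fewer_zeros (\<lambda>t. \<Sum>k\<in>K. c k * exp (l k * t)) UNIV (card K)"
  using assms
proof (induction K arbitrary: c l)
  case empty
  then show ?case by (simp add: fewer_zeros_def)
next
  case (insert a K)
  let ?g = "\<lambda>t. c a + (\<Sum>k\<in>K. c k * exp ((l k - l a) * t))"
  let ?g' = "\<lambda>t. \<Sum>k\<in>K. (c k * (l k - l a)) * exp ((l k - l a) * t)"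
  have "(?g has_real_derivative ?g' t) (at t)" for t
    by (auto intro!: derivative_eq_intros sum.cong)
  then have "fewer_zeros ?g UNIV (Suc (card K))"
    by (intro fewer_zeros_Rolle[where f' = ?g'] insert.IH) auto
  moreover have "(\<Sum>k\<in>insert a K. c k * exp (l k * t)) = exp (l a * t) * ?g t" for t
    using insert.hyps by (simp add: sum_distrib_left distrib_left algebra_simps flip: exp_add)
  ultimately show ?case using insert.hyps
    by (auto intro: fewer_zeros_cong_zeros)
qed

section \<open>Sums of powers of u and 1 - u with polynomial coefficients\<close>

text \<open>
A monomial on the segment \<open>u + v = 1\<close> of the positive quadrant.
\<close>

definition beta_term :: "real \<Rightarrow> real \<Rightarrow> real \<Rightarrow> real" where
  "beta_term \<alpha> \<beta> u = u powr \<alpha> * (1 - u) powr \<beta>"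

lemma beta_term_pos: "u \<in> {0<..<1} \<Longrightarrow> 0 < beta_term \<alpha> \<beta> u"
  by (simp add: beta_term_def)

lemma beta_term_mult:
  "beta_term \<alpha> \<beta> u * beta_term \<alpha>' \<beta>' u = beta_term (\<alpha> + \<alpha>') (\<beta> + \<beta>') u"
  by (simp add: beta_term_def powr_add)

lemma has_derivative_beta_term:
  assumes u: "u \<in> {0<..<1}"
  shows "(beta_term \<alpha> \<beta> has_real_derivative (\<alpha> - (\<alpha> + \<beta>) * u) * beta_term (\<alpha> - 1) (\<beta> - 1) u) (at u)"
proof -
  have "((\<lambda>u. u powr \<alpha> * (1 - u) powr \<beta>) has_real_derivative
      \<alpha> * u powr (\<alpha> - 1) * (1 - u) powr \<beta> - u powr \<alpha> * (\<beta> * (1 - u) powr (\<beta> - 1))) (at u)"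
    using u by (auto intro!: derivative_eq_intros simp: powr_diff field_simps)
  moreover have "u powr \<alpha> = u * u powr (\<alpha> - 1)" "(1 - u) powr \<beta> = (1 - u) * (1 - u) powr (\<beta> - 1)"
    using u by (simp_all add: powr_mult_base)
  ultimately show ?thesis unfolding beta_term_def[abs_def]
    by (simp add: algebra_simps)
qed

text \<open>
The polynomial that replaces \<open>p\<close> when \<open>p(u) u\<^sup>\<alpha> (1 - u)\<^sup>\<beta>\<close> is differentiated and both exponents are
lowered by one.
\<close>

definition beta_deriv_poly :: "real \<Rightarrow> real \<Rightarrow> real poly \<Rightarrow> real poly" where
  "beta_deriv_poly \<alpha> \<beta> p = pderiv p * [:0, 1, -1:] + p * [:\<alpha>, - (\<alpha> + \<beta>):]"

lemma coeff_beta_deriv_poly: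
  assumes "\<forall>i\<ge>e. coeff p i = 0"
  shows "\<forall>i\<ge>Suc e. coeff (beta_deriv_poly \<alpha> \<beta> p) i = 0"
proof (intro allI impI)
  fix i assume "Suc e \<le> i"
  then obtain j where j: "i = Suc j" "e \<le> j" by (metis Suc_le_D Suc_le_mono)
  then have "coeff (pCons 0 (pderiv p)) j = 0" "coeff (pCons 0 (- pderiv p)) j = 0"
    using assms by (cases j; auto simp: coeff_pderiv)+
  then show "coeff (beta_deriv_poly \<alpha> \<beta> p) i = 0"
    using j assms by (simp add: beta_deriv_poly_def coeff_pderiv)
qed

lemma has_derivative_poly_beta_term:
  assumes u: "u \<in> {0<..<1}"
  shows "((\<lambda>u. poly p u * beta_term \<alpha> \<beta> u) has_real_derivative
    poly (beta_deriv_poly \<alpha> \<beta> p) u * beta_term (\<alpha> - 1) (\<beta> - 1) u) (at u)"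
proof -
  have "beta_term \<alpha> \<beta> u = beta_term 1 1 u * beta_term (\<alpha> - 1) (\<beta> - 1) u"
    by (simp add: beta_term_mult)
  also have "beta_term 1 1 u = u * (1 - u)" using u by (simp add: beta_term_def)
  finally have b: "beta_term \<alpha> \<beta> u = u * (1 - u) * beta_term (\<alpha> - 1) (\<beta> - 1) u" .
  have "((\<lambda>u. poly p u * beta_term \<alpha> \<beta> u) has_real_derivative
     poly (pderiv p) u * beta_term \<alpha> \<beta> u
      + poly p u * ((\<alpha> - (\<alpha> + \<beta>) * u) * beta_term (\<alpha> - 1) (\<beta> - 1) u)) (at u)"
    by (rule derivative_eq_intros poly_DERIV has_derivative_beta_term u refl)+ simp
  then show ?thesis
    unfolding b by (simp add: beta_deriv_poly_def algebra_simps)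
qed

text \<open>
The step of the counting argument: \<open>r\<close> differentiations remove a polynomial of degree less
than \<open>r\<close>, at the cost of one zero each, and they raise the degree bound of the other coefficients
from \<open>e\<close> to \<open>e + r\<close>.  The hypothesis on sums over \<open>K\<close> is the induction hypothesis of the next lemma, where
\<open>N\<close> is \<open>2\<^sup>k - 1\<close> for \<open>k\<close> terms.
\<close>

lemma fewer_zeros_poly_plus_beta_sum:
  assumes K: "finite K"
    and IH: "\<And>e p \<alpha> \<beta>. (\<And>k. k \<in> K \<Longrightarrow> \<forall>i\<ge>e. coeff (p k) i = 0) \<Longrightarrow>
      fewer_zeros (\<lambda>u. \<Sum>k\<in>K. poly (p k) u * beta_term (\<alpha> k) (\<beta> k) u) {0<..<1} (e * N)"
    and p: "\<And>k. k \<in> K \<Longrightarrow> \<forall>i\<ge>e. coeff (p k) i = 0"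
    and q: "\<forall>i\<ge>r. coeff q i = 0"
  shows "fewer_zeros (\<lambda>u. poly q u + (\<Sum>k\<in>K. poly (p k) u * beta_term (\<alpha> k) (\<beta> k) u)) {0<..<1}
    (r + (e + r) * N)"
  using p q
proof (induction r arbitrary: e p q \<alpha> \<beta>)
  case 0
  then have "q = 0" by (simp add: poly_eqI)
  then show ?case using IH[OF 0(1)] by simp
next
  case (Suc r)
  let ?dp = "\<lambda>k. beta_deriv_poly (\<alpha> k) (\<beta> k) (p k)"
  let ?f = "\<lambda>u. poly q u + (\<Sum>k\<in>K. poly (p k) u * beta_term (\<alpha> k) (\<beta> k) u)"
  let ?f' = "\<lambda>u. poly (pderiv q) u + (\<Sum>k\<in>K. poly (?dp k) u * beta_term (\<alpha> k - 1) (\<beta> k - 1) u)"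
  have "(?f has_real_derivative ?f' u) (at u)" if "u \<in> {0<..<1}" for u
    by (intro derivative_intros poly_DERIV has_derivative_poly_beta_term that)
  moreover have "fewer_zeros ?f' {0<..<1} (r + (Suc e + r) * N)"
  proof (intro Suc.IH)
    show "\<forall>i\<ge>Suc e. coeff (?dp k) i = 0" if "k \<in> K" for k
      by (rule coeff_beta_deriv_poly[OF Suc.prems(1)[OF that]])
    show "\<forall>i\<ge>r. coeff (pderiv q) i = 0"
      using Suc.prems(2) by (auto simp: coeff_pderiv)
  qed
  ultimately have "fewer_zeros ?f {0<..<1} (Suc (r + (Suc e + r) * N))"
    by (intro fewer_zeros_Rolle[where f' = ?f']) auto
  then show ?case by simp
qed

text \<open>
Dividing by the powers in one term leaves a polynomial there, which the preceding lemma
removes; the bound \<open>b(k, e)\<close> for \<open>k\<close> terms thus satisfies \<open>b(k + 1, e) = e + b(k, 2 e)\<close>.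
\<close>

lemma fewer_zeros_beta_sum:
  assumes "finite K" "\<And>k. k \<in> K \<Longrightarrow> \<forall>i\<ge>e. coeff (p k) i = 0"
  shows "fewer_zeros (\<lambda>u. \<Sum>k\<in>K. poly (p k) u * beta_term (\<alpha> k) (\<beta> k) u) {0<..<1}
    (e * (2 ^ card K - 1))"
  using assms
proof (induction K arbitrary: e p \<alpha> \<beta>)
  case empty
  then show ?case by (simp add: fewer_zeros_def)
next
  case (insert a K)
  let ?g = "\<lambda>u. poly (p a) u + (\<Sum>k\<in>K. poly (p k) u * beta_term (\<alpha> k - \<alpha> a) (\<beta> k - \<beta> a) u)"
  have bound: "fewer_zeros ?g {0<..<1} (e + (e + e) * (2 ^ card K - 1))"
    by (rule fewer_zeros_poly_plus_beta_sum[OF insert.hyps(1) insert.IH]) (simp_all add: insert.prems)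
  have card_eq: "e + (e + e) * (2 ^ card K - 1) = e * (2 ^ card (insert a K) - 1)"
  proof -
    obtain N where "(2::nat) ^ card K = Suc N"
      using not0_implies_Suc[of "2 ^ card K"] by auto
    then show ?thesis using insert.hyps by (simp add: algebra_simps)
  qed
  have factor: "(\<Sum>k\<in>insert a K. poly (p k) u * beta_term (\<alpha> k) (\<beta> k) u) = beta_term (\<alpha> a) (\<beta> a) u * ?g u" for u
  proof -
    have eq: "poly (p k) u * beta_term (\<alpha> k) (\<beta> k) u
      = beta_term (\<alpha> a) (\<beta> a) u * (poly (p k) u * beta_term (\<alpha> k - \<alpha> a) (\<beta> k - \<beta> a) u)" for k
      using beta_term_mult[of "\<alpha> a" "\<beta> a" u "\<alpha> k - \<alpha> a" "\<beta> k - \<beta> a"] by (simp add: mult.left_commute)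
    have "(\<Sum>k\<in>K. poly (p k) u * beta_term (\<alpha> k) (\<beta> k) u) = beta_term (\<alpha> a) (\<beta> a) u
        * (\<Sum>k\<in>K. poly (p k) u * beta_term (\<alpha> k - \<alpha> a) (\<beta> k - \<beta> a) u)"
      unfolding sum_distrib_left by (rule sum.cong[OF refl eq])
    then show ?thesis unfolding sum.insert[OF insert.hyps] distrib_left by (simp only: mult.commute)
  qed
  show ?case
  proof (rule fewer_zeros_cong_zeros)
    show "fewer_zeros ?g {0<..<1} (e * (2 ^ card (insert a K) - 1))"
      using bound unfolding card_eq .
    show "(\<Sum>k\<in>insert a K. poly (p k) u * beta_term (\<alpha> k) (\<beta> k) u) = 0 \<longleftrightarrow> ?g u = 0"
      if "u \<in> {0<..<1}" for u
      unfolding factor using beta_term_pos[OF that, of "\<alpha> a" "\<beta> a"] by simp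
  qed
qed

section \<open>Three terms have at most five zeros\<close>

text \<open>
The linear factor of the derivative of \<open>x\<^sup>a (1 - x)\<^sup>b\<close>.
\<close>

definition lin :: "real \<Rightarrow> real \<Rightarrow> real \<Rightarrow> real" where
  "lin a b x = a - (a + b) * x"

text \<open>
The derivative of \<open>C + A x\<^sup>a (1 - x)\<^sup>b + B x\<^sup>c (1 - x)\<^sup>d\<close>, divided by \<open>x\<^sup>c\<^sup>-\<^sup>1 (1 - x)\<^sup>d\<^sup>-\<^sup>1\<close>.
\<close>

definition crit_fun :: "real \<Rightarrow> real \<Rightarrow> real \<Rightarrow> real \<Rightarrow> real \<Rightarrow> real \<Rightarrow> real \<Rightarrow> real" where
  "crit_fun A B a b c d x = A * beta_term (a - c) (b - d) x * lin a b x + B * lin c d x"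

text \<open>
The numerator in the derivative of the quotient of the two summands of \<^const>\<open>crit_fun\<close>.  The
summand \<open>(a d - b c) x (1 - x)\<close> comes from the quotient of the linear factors, whose Wronskian
\<open>lin' a b \<sqdot> lin c d - lin a b \<sqdot> lin' c d\<close> is the constant \<open>a d - b c\<close>.
\<close>

definition crit_cubic :: "real \<Rightarrow> real \<Rightarrow> real \<Rightarrow> real \<Rightarrow> real \<Rightarrow> real" where
  "crit_cubic a b c d x =
     lin (a - c) (b - d) x * lin a b x * lin c d x + (a * d - b * c) * x * (1 - x)"

lemma beta_term_eq_0_iff [simp]: "beta_term \<alpha> \<beta> u = 0 \<longleftrightarrow> u = 0 \<or> u = 1"
  by (auto simp: beta_term_def)

lemma beta_term_split:
  assumes "u \<in> {0<..<1}"
  shows "beta_term \<alpha> \<beta> u = u * (1 - u) * beta_term (\<alpha> - 1) (\<beta> - 1) u"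
  using beta_term_mult[of 1 1 u "\<alpha> - 1" "\<beta> - 1"] assms by (simp add: beta_term_def)

lemma fewer_zeros_of_crit_fun:
  assumes "fewer_zeros (crit_fun A B a b c d) {0<..<1} n"
  shows "fewer_zeros (\<lambda>x. C + A * beta_term a b x + B * beta_term c d x) {0<..<1} (Suc n)"
proof -
  let ?F' = "\<lambda>x. beta_term (c - 1) (d - 1) x * crit_fun A B a b c d x"
  have "((\<lambda>x. C + A * beta_term a b x + B * beta_term c d x) has_real_derivative ?F' x) (at x)"
    if x: "x \<in> {0<..<1}" for x
  proof -
    have "beta_term (a - 1) (b - 1) x = beta_term (c - 1) (d - 1) x * beta_term (a - c) (b - d) x"
      by (simp add: beta_term_mult)
    moreover have "((\<lambda>x. C + A * beta_term a b x + B * beta_term c d x) has_real_derivative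
       A * (lin a b x * beta_term (a - 1) (b - 1) x) + B * (lin c d x * beta_term (c - 1) (d - 1) x)) (at x)"
      unfolding lin_def by (rule derivative_eq_intros has_derivative_beta_term x refl)+ simp
    ultimately show ?thesis by (simp add: crit_fun_def algebra_simps)
  qed
  moreover have "fewer_zeros ?F' {0<..<1} n"
    using assms by (rule fewer_zeros_cong_zeros) auto
  ultimately show ?thesis by (intro fewer_zeros_Rolle[where f' = ?F']) auto
qed

lemma fewer_zeros_lin: "fewer_zeros (lin a b) I 2"
proof -
  have "lin a b = poly [:a, - (a + b):]" by (auto simp: lin_def algebra_simps)
  then show ?thesis
    by (auto intro!: fewer_zeros_poly simp: coeff_pCons split: nat.split)
qed

lemma fewer_zeros_crit_cubic: "fewer_zeros (crit_cubic a b c d) I 4"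
proof -
  let ?p = "[:a - c, - (a - c + (b - d)):] * [:a, - (a + b):] * [:c, - (c + d):]
    + smult (a * d - b * c) [:0, 1, -1:]"
  have "crit_cubic a b c d x = poly ?p x" for x
    unfolding crit_cubic_def lin_def poly_add poly_mult poly_smult by (simp add: algebra_simps)
  moreover have "fewer_zeros (poly ?p) I 4"
    by (rule fewer_zeros_poly) (auto simp: coeff_pCons split: nat.split)
  ultimately show ?thesis using fewer_zeros_cong_zeros[of "poly ?p" I 4] by metis
qed

lemma has_derivative_crit_quotient:
  assumes x: "x \<in> {0<..<1}" and nz: "lin c d x \<noteq> 0"
  shows "((\<lambda>x. crit_fun A B a b c d x / lin c d x) has_real_derivative
    A * beta_term (a - c - 1) (b - d - 1) x / (lin c d x)\<^sup>2 * crit_cubic a b c d x) (at x)"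
proof -
  have lin': "(lin e f has_real_derivative - (e + f)) (at x)" for e f
    unfolding lin_def[abs_def] by (auto intro!: derivative_eq_intros)
  have bt': "(beta_term (a - c) (b - d) has_real_derivative
      lin (a - c) (b - d) x * beta_term (a - c - 1) (b - d - 1) x) (at x)"
    unfolding lin_def by (rule has_derivative_beta_term[OF x])
  let ?t = "beta_term (a - c - 1) (b - d - 1) x"
  let ?N = "A * (lin (a - c) (b - d) x * ?t) * lin a b x
      + A * beta_term (a - c) (b - d) x * - (a + b) + B * - (c + d)"
  have "((\<lambda>x. crit_fun A B a b c d x / lin c d x) has_real_derivative
      (?N * lin c d x - crit_fun A B a b c d x * - (c + d)) / (lin c d x * lin c d x)) (at x)"
    unfolding crit_fun_def using nz
    by (auto intro!: derivative_eq_intros lin' bt' simp: algebra_simps)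
  moreover have "?N * lin c d x - crit_fun A B a b c d x * - (c + d)
      = A * ?t * crit_cubic a b c d x"
  proof -
    have "lin a b x * (c + d) - (a + b) * lin c d x = a * d - b * c"
      by (simp add: lin_def algebra_simps)
    then have w: "T * lin a b x * (c + d) - T * (a + b) * lin c d x = T * (a * d - b * c)" for T
      by (metis mult.assoc right_diff_distrib)
    have "?N * lin c d x - crit_fun A B a b c d x * - (c + d)
      = A * ?t * (lin (a - c) (b - d) x * lin a b x * lin c d x)
        + (A * beta_term (a - c) (b - d) x * lin a b x * (c + d)
           - A * beta_term (a - c) (b - d) x * (a + b) * lin c d x)"
      by (simp add: crit_fun_def algebra_simps)
    also have "\<dots> = A * ?t * crit_cubic a b c d x"
      unfolding w beta_term_split[OF x, of "a - c" "b - d"] by (simp add: crit_cubic_def algebra_simps)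
    finally show ?thesis .
  qed
  ultimately show ?thesis by (simp add: power2_eq_square)
qed

lemma crit_cubic_zero_iff:
  assumes "x \<in> {0<..<1}" "lin c d x \<noteq> 0" "A \<noteq> 0"
  shows "A * beta_term (a - c - 1) (b - d - 1) x / (lin c d x)\<^sup>2 * crit_cubic a b c d x = 0
    \<longleftrightarrow> crit_cubic a b c d x = 0"
  using assms beta_term_pos[OF assms(1), of "a - c - 1" "b - d - 1"] by simp

text \<open>
For proportional exponent vectors the two linear factors are proportional as well, so that
\<^const>\<open>crit_fun\<close> is the product of a linear function and a function whose derivative has only a
linear factor.
\<close>

lemma fewer_zeros_crit_fun_parallel:
  assumes par: "a * d = b * c"
  shows "fewer_zeros (crit_fun A B a b c d) {0<..<1} 4"
proof (cases "c = 0 \<and> d = 0")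
  case True
  show ?thesis
  proof (cases "A = 0")
    case True
    then show ?thesis using \<open>c = 0 \<and> d = 0\<close> by (simp add: fewer_zeros_def crit_fun_def lin_def)
  next
    case False
    then have "fewer_zeros (crit_fun A B a b c d) {0<..<1} 2"
      by (intro fewer_zeros_cong_zeros[OF fewer_zeros_lin[of a b]])
        (use True in \<open>auto simp: crit_fun_def lin_def\<close>)
    then show ?thesis by (rule fewer_zeros_mono) simp
  qed
next
  case False
  have "\<exists>r. a = r * c \<and> b = r * d"
  proof (cases "c = 0")
    case True
    then show ?thesis using par False by (intro exI[of _ "b / d"]) auto
  next
    case c: False
    then show ?thesis using par by (intro exI[of _ "a / c"]) (auto simp: field_simps)
  qed
  then obtain r where r: "a = r * c" "b = r * d" by blast
  let ?g = "\<lambda>x. B + A * r * beta_term (a - c) (b - d) x"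
  let ?g' = "\<lambda>x. A * r * (lin (a - c) (b - d) x * beta_term (a - c - 1) (b - d - 1) x)"
  have "(?g has_real_derivative ?g' x) (at x)" if "x \<in> {0<..<1}" for x
    unfolding lin_def by (rule derivative_eq_intros has_derivative_beta_term that refl)+ simp
  moreover have "fewer_zeros ?g' {0<..<1} 2"
  proof (cases "A * r = 0")
    case True
    then show ?thesis by (auto simp: fewer_zeros_def)
  next
    case nz: False
    show ?thesis
      by (rule fewer_zeros_cong_zeros[OF fewer_zeros_lin[of "a - c" "b - d"]]) (use nz in auto)
  qed
  ultimately have "fewer_zeros ?g {0<..<1} (Suc 2)"
    by (intro fewer_zeros_Rolle[where f' = ?g']) auto
  then have "fewer_zeros (\<lambda>x. lin c d x * ?g x) {0<..<1} (Suc (1 + 2))"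
    by (intro fewer_zeros_mult) (use fewer_zeros_lin in \<open>auto simp: numeral_2_eq_2\<close>)
  moreover have "crit_fun A B a b c d = (\<lambda>x. lin c d x * ?g x)"
    unfolding crit_fun_def r lin_def by (rule ext) (simp add: algebra_simps)
  ultimately show ?thesis by (simp only: Suc_numeral semiring_norm)
qed

text \<open>
Since \<open>A\<close> and \<open>B\<close> have the same sign, the two summands can cancel only if the linear factors have
opposite signs.  They cannot both vanish, for \<open>(a, b)\<close> and \<open>(c, d)\<close> would then be orthogonal to the
same vector \<open>(1 - x, -x)\<close>.
\<close>

lemma crit_fun_zero_opposite_signs:
  assumes AB: "A * B > 0" and det: "a * d \<noteq> b * c" and x: "x \<in> {0<..<1}"
    and z: "crit_fun A B a b c d x = 0"
  shows "lin a b x * lin c d x < 0"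
proof -
  let ?t = "beta_term (a - c) (b - d) x"
  have t: "?t > 0" using beta_term_pos[OF x] .
  have eq: "A * ?t * lin a b x = - B * lin c d x" using z by (simp add: crit_fun_def)
  have "lin c d x \<noteq> 0"
  proof
    assume c: "lin c d x = 0"
    then have "lin a b x = 0" using eq AB t x by auto
    then have "a * (1 - x) = b * x" "c * (1 - x) = d * x" using c by (auto simp: lin_def algebra_simps)
    then have "a * d * (x * (1 - x)) = b * c * (x * (1 - x))" by algebra
    then show False using det x by simp
  qed
  have "A * A * ?t * (lin a b x * lin c d x) = (A * lin c d x) * (A * ?t * lin a b x)"
    by (simp add: algebra_simps)
  also have "\<dots> = - (A * B * (lin c d x)\<^sup>2)"
    unfolding eq by (simp add: power2_eq_square algebra_simps)
  also have "\<dots> < 0" using AB \<open>lin c d x \<noteq> 0\<close> by simp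
  finally have "A * A * ?t * (lin a b x * lin c d x) < 0" .
  moreover have "A * A * ?t > 0" using AB t by (auto simp: zero_less_mult_iff)
  ultimately show ?thesis by (metis mult_less_0_iff not_less_iff_gr_or_eq)
qed

lemma continuous_on_crit_fun: "continuous_on {0<..<1} (crit_fun A B a b c d)"
  unfolding crit_fun_def[abs_def] beta_term_def lin_def
  by (intro continuous_intros) auto

text \<open>
On the interval \<open>J\<close> the quotient by \<open>lin c d\<close> is defined and its derivative vanishes only with a cubic.
If \<^const>\<open>crit_fun\<close> vanished on all of \<open>J\<close>, then \<open>J\<close> would be its zero set in \<open>(0, 1)\<close>, hence both open and
closed there, so that \<open>J\<close> is empty or the whole interval.
\<close>

lemma fewer_zeros_crit_fun_interval:
  assumes AB: "A * B > 0" and det: "a * d \<noteq> b * c"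
    and J: "is_interval {x\<in>{0<..<1}. lin a b x * lin c d x < 0}"
  shows "fewer_zeros (crit_fun A B a b c d) {0<..<1} 5"
proof -
  define J where "J = {x\<in>{0<..<1}. lin a b x * lin c d x < 0}"
  let ?H = "crit_fun A B a b c d"
  have zeros: "{x\<in>{0<..<1}. ?H x = 0} = {x\<in>J. ?H x = 0}"
    using crit_fun_zero_opposite_signs[OF AB det] by (auto simp: J_def)
  have "fewer_zeros (\<lambda>x. ?H x / lin c d x) J (Suc 4)"
  proof (rule fewer_zeros_Rolle)
    show "is_interval J" using J by (simp add: J_def)
    show "((\<lambda>x. ?H x / lin c d x) has_real_derivative
      A * beta_term (a - c - 1) (b - d - 1) x / (lin c d x)\<^sup>2 * crit_cubic a b c d x) (at x)"
      if "x \<in> J" for x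
      by (rule has_derivative_crit_quotient) (use that in \<open>auto simp: J_def\<close>)
    show "fewer_zeros (\<lambda>x. A * beta_term (a - c - 1) (b - d - 1) x / (lin c d x)\<^sup>2
        * crit_cubic a b c d x) J 4"
      by (rule fewer_zeros_cong_zeros[OF fewer_zeros_crit_cubic crit_cubic_zero_iff])
        (use AB in \<open>auto simp: J_def\<close>)
  qed
  moreover have "lin c d x \<noteq> 0" if "x \<in> J" for x using that by (auto simp: J_def)
  ultimately have "fewer_zeros ?H J 5"
    using fewer_zeros_cong_zeros[of "\<lambda>x. ?H x / lin c d x" J 5 ?H] by auto
  then consider "finite {x\<in>J. ?H x = 0}" "card {x\<in>J. ?H x = 0} < 5" | "\<forall>x\<in>J. ?H x = 0"
    unfolding fewer_zeros_def by blast
  then show ?thesis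
  proof cases
    case 1
    then show ?thesis unfolding fewer_zeros_def zeros by blast
  next
    case 2
    then have J_eq: "J = {x\<in>{0<..<1}. ?H x = 0}" unfolding zeros by auto
    have "closedin (top_of_set {0<..<1}) J"
      unfolding J_eq by (intro continuous_closedin_preimage_constant continuous_on_crit_fun)
    moreover have "openin (top_of_set {0<..<1}) J"
    proof -
      have "open {x. lin a b x * lin c d x < 0}"
        unfolding lin_def by (intro open_Collect_less continuous_intros)
      moreover have "J = {0<..<1} \<inter> {x. lin a b x * lin c d x < 0}" by (auto simp: J_def)
      ultimately show ?thesis by (simp add: openin_open_Int)
    qed
    moreover have "connected {0<..<1::real}" by simp
    ultimately have "J = {} \<or> J = {0<..<1}" by (metis connected_clopen)
    then show ?thesis
    proof
      assume "J = {}"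
      then show ?thesis unfolding fewer_zeros_def J_eq[symmetric] by simp
    next
      assume "J = {0<..<1}"
      then show ?thesis using 2 unfolding fewer_zeros_def by simp
    qed
  qed
qed

lemma lin_pos_between:
  assumes "lin a b x > 0" "lin a b z > 0" "x \<le> y" "y \<le> z"
  shows "lin a b y > 0"
proof (cases "a + b \<ge> 0")
  case True
  then have "(a + b) * y \<le> (a + b) * z" using assms by (simp add: mult_left_mono)
  then show ?thesis using assms by (simp add: lin_def)
next
  case False
  then have "(a + b) * y \<le> (a + b) * x" using assms by (simp add: mult_left_mono_neg)
  then show ?thesis using assms by (simp add: lin_def)
qed

lemma lin_neg: "lin (- a) (- b) x = - lin a b x"
  by (simp add: lin_def algebra_simps)

lemma lin_neg_between:
  assumes "lin a b x < 0" "lin a b z < 0" "x \<le> y" "y \<le> z"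
  shows "lin a b y < 0"
  using lin_pos_between[of "- a" "- b" x z y] assms by (simp add: lin_neg)

text \<open>
The values of \<open>lin a b\<close> at \<open>0\<close> and \<open>1\<close> are \<open>a\<close> and \<open>- b\<close>.
\<close>

lemma lin_pos_then_neg:
  assumes "lin a b x > 0" "lin a b z < 0" "0 < x" "x < z" "z < 1"
  shows "a > 0" "b > 0"
proof -
  have "(a + b) * x < (a + b) * z" using assms by (simp add: lin_def)
  then have "a + b > 0" using assms by (simp add: mult_less_cancel_left)
  then have "(a + b) * x > 0" "(a + b) * z < a + b" using assms by auto
  then show "a > 0" "b > 0" using assms by (auto simp: lin_def)
qed

text \<open>
If both factors change sign between \<open>x\<close> and \<open>z\<close>, one of them decreases and the other increases,
which determines the signs of their values at \<open>0\<close> and \<open>1\<close>.  Otherwise both keep their sign between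
\<open>x\<close> and \<open>z\<close>.
\<close>

lemma opposite_signs_interval:
  assumes "\<not> (a > 0 \<and> b > 0 \<and> c < 0 \<and> d < 0)" "\<not> (a < 0 \<and> b < 0 \<and> c > 0 \<and> d > 0)"
  shows "is_interval {x\<in>{0<..<1}. lin a b x * lin c d x < 0}"
  unfolding is_interval_1
proof (intro ballI allI impI)
  fix x z y
  assume x: "x \<in> {x\<in>{0<..<1}. lin a b x * lin c d x < 0}"
    and z: "z \<in> {x\<in>{0<..<1}. lin a b x * lin c d x < 0}" and y: "x \<le> y \<and> y \<le> z"
  show "y \<in> {x\<in>{0<..<1}. lin a b x * lin c d x < 0}"
  proof (cases "x = z")
    case False
    then have "x < z" using y by simp
    then have no1: "\<not> (lin a b x > 0 \<and> lin a b z < 0 \<and> lin c d x < 0 \<and> lin c d z > 0)"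
      and no2: "\<not> (lin a b x < 0 \<and> lin a b z > 0 \<and> lin c d x > 0 \<and> lin c d z < 0)"
      using lin_pos_then_neg[of a b x z] lin_pos_then_neg[of c d x z]
        lin_pos_then_neg[of "-a" "-b" x z] lin_pos_then_neg[of "-c" "-d" x z] assms x z
      by (auto simp: lin_neg)
    have "lin a b x > 0 \<and> lin c d x < 0 \<or> lin a b x < 0 \<and> lin c d x > 0"
      "lin a b z > 0 \<and> lin c d z < 0 \<or> lin a b z < 0 \<and> lin c d z > 0"
      using x z by (auto simp: mult_less_0_iff)
    then have "lin a b y > 0 \<and> lin c d y < 0 \<or> lin a b y < 0 \<and> lin c d y > 0"
      using no1 no2 lin_pos_between[of _ _ x z y] lin_neg_between[of _ _ x z y] y by blast
    then show ?thesis using x z y by (auto simp: mult_less_0_iff)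
  qed (use x y in auto)
qed

text \<open>
The region of opposite signs is \<open>(0, p) \<union> (q, 1)\<close> for the zeros \<open>p < q\<close> of the two linear factors.  The
cubic is positive on \<open>(q, 1)\<close>.  On \<open>(0, p)\<close> its zeros are the solutions of an equation between an
increasing and a decreasing function, so there is at most one.
\<close>

lemma fewer_zeros_crit_fun_two_sided:
  assumes sg: "a > 0" "b > 0" "c < 0" "d < 0" and det: "a * d > b * c" and AB: "A * B > 0"
  shows "fewer_zeros (crit_fun A B a b c d) {0<..<1} 4"
proof -
  \<comment> \<open>up to the factors \<open>s\<close> and \<open>w\<close>, the linear factors are \<open>p - x\<close> and \<open>x - q\<close>\<close>
  define s w p q where "s = a + b" and "w = - (c + d)" and "p = a / (a + b)" and "q = c / (c + d)"
  have sw: "s > 0" "w > 0" using sg by (auto simp: s_def w_def)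
  have a: "a = p * s" and c: "c = - q * w" and b: "b = (1 - p) * s" and d: "d = - (1 - q) * w"
    using sg by (auto simp: s_def w_def p_def q_def field_simps)
  have p: "0 < p" "p < 1" and q: "0 < q" "q < 1"
    using sg by (auto simp: p_def q_def field_simps)
  have "a * d - b * c = s * w * (q - p)" unfolding a b c d by (simp add: algebra_simps)
  then have "s * w * (q - p) > 0" using det by simp
  then have pq: "p < q" using mult_pos_pos[OF sw] by (simp add: zero_less_mult_iff)
  have lab: "lin a b x = s * (p - x)" and lcd: "lin c d x = - w * (q - x)" for x
    unfolding a b c d lin_def by (simp_all add: algebra_simps)
  have cubic: "crit_cubic a b c d x
      = s * w * ((q - p) * (x * (1 - x)) - (p - x) * (q - x) * (s * (p - x) + w * (q - x)))" for x
    unfolding crit_cubic_def lin_def a b c d by (simp add: algebra_simps)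
  let ?H = "crit_fun A B a b c d"
  let ?Q = "\<lambda>x. A * beta_term (a - c - 1) (b - d - 1) x / (lin c d x)\<^sup>2 * crit_cubic a b c d x"
  have bound: "finite {x\<in>J. ?H x = 0} \<and> card {x\<in>J. ?H x = 0} < Suc n"
    if J: "is_interval J" "J \<subseteq> {0<..<1}" "q \<notin> J"
      and N: "finite {x\<in>J. crit_cubic a b c d x = 0}" "card {x\<in>J. crit_cubic a b c d x = 0} < n" for J n
  proof -
    have nz: "lin c d x \<noteq> 0" if "x \<in> J" for x using that J sw by (auto simp: lcd)
    have "A \<noteq> 0" using AB by auto
    then have "{x\<in>J. ?Q x = 0} = {x\<in>J. crit_cubic a b c d x = 0}"
      using crit_cubic_zero_iff nz J(2) by blast
    then have "finite {x\<in>J. ?H x / lin c d x = 0} \<and> card {x\<in>J. ?H x / lin c d x = 0} < Suc n"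
      using N has_derivative_crit_quotient nz J(2)
      by (intro finite_zeros_Rolle[OF J(1), where f' = ?Q]) auto
    moreover have "{x\<in>J. ?H x / lin c d x = 0} = {x\<in>J. ?H x = 0}" using nz by auto
    ultimately show ?thesis by simp
  qed
  have right: "finite {x\<in>{q<..<1}. ?H x = 0} \<and> card {x\<in>{q<..<1}. ?H x = 0} < Suc 1"
  proof (rule bound)
    have "crit_cubic a b c d x > 0" if "x \<in> {q<..<1}" for x
    proof -
      have "(p - x) * (q - x) > 0" using that pq by (simp add: mult_neg_neg)
      moreover have "s * (p - x) + w * (q - x) < 0"
        using that pq sw by (intro add_neg_neg) (auto simp: mult_pos_neg)
      ultimately have "(p - x) * (q - x) * (s * (p - x) + w * (q - x)) < 0" by (rule mult_pos_neg)
      moreover have "(q - p) * (x * (1 - x)) > 0" using that pq q by simp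
      ultimately show ?thesis unfolding cubic using sw by simp
    qed
    then have "{x\<in>{q<..<1}. crit_cubic a b c d x = 0} = {}" by (auto simp: less_le)
    then show "finite {x\<in>{q<..<1}. crit_cubic a b c d x = 0}"
      "card {x\<in>{q<..<1}. crit_cubic a b c d x = 0} < 1" by (simp_all only: card.empty) auto
  qed (use q in auto)
  have left: "finite {x\<in>{0<..<p}. ?H x = 0} \<and> card {x\<in>{0<..<p}. ?H x = 0} < Suc 2"
  proof (rule bound)
    \<comment> \<open>\<open>x / (q - x)\<close> and \<open>(1 - x) / (p - x) = 1 + (1 - p) / (p - x)\<close> both increase on \<open>(0, p)\<close>\<close>
    have zero: "(q - p) * (x / (q - x) * ((1 - x) / (p - x))) = s * (p - x) + w * (q - x)"
      if "x \<in> {0<..<p}" "crit_cubic a b c d x = 0" for x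
    proof -
      have "p - x > 0" "q - x > 0" using that pq by auto
      moreover have "(q - p) * (x * (1 - x)) = (p - x) * (q - x) * (s * (p - x) + w * (q - x))"
        using that sw unfolding cubic by simp
      moreover have "(q - p) * (x / (q - x) * ((1 - x) / (p - x)))
          = (q - p) * (x * (1 - x)) / ((p - x) * (q - x))"
        by (simp add: mult.commute)
      ultimately show ?thesis by simp
    qed
    have uniq: False if x: "x \<in> {0<..<p}" "crit_cubic a b c d x = 0"
      and y: "y \<in> {0<..<p}" "crit_cubic a b c d y = 0" and "x < y" for x y
    proof -
      have "x / (q - x) < y / (q - y)" "(1 - x) / (p - x) < (1 - y) / (p - y)"
      proof -
        have "x / (q - x) \<le> x / (q - y)"
          using x y pq \<open>x < y\<close> by (intro divide_left_mono mult_pos_pos) auto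
        also have "\<dots> < y / (q - y)" using x y pq \<open>x < y\<close> by (intro divide_strict_right_mono) auto
        finally show "x / (q - x) < y / (q - y)" .
        have "0 < (1 - p) * (y - x)" using p \<open>x < y\<close> by simp
        then show "(1 - x) / (p - x) < (1 - y) / (p - y)"
          using x y by (simp add: divide_simps) (simp add: algebra_simps)
      qed
      then have "x / (q - x) * ((1 - x) / (p - x)) < y / (q - y) * ((1 - y) / (p - y))"
        using x y pq p by (intro mult_strict_mono) auto
      then have "s * (p - x) + w * (q - x) < s * (p - y) + w * (q - y)"
        using zero[OF x] zero[OF y] pq by (metis diff_gt_0_iff_gt mult_strict_left_mono)
      moreover have "s * (p - y) < s * (p - x)" "w * (q - y) < w * (q - x)"
        using sw \<open>x < y\<close> by auto
      ultimately show False by simp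
    qed
    have "\<exists>x. {x\<in>{0<..<p}. crit_cubic a b c d x = 0} \<subseteq> {x}"
    proof (cases "{x\<in>{0<..<p}. crit_cubic a b c d x = 0} = {}")
      case False
      then obtain x where x: "x \<in> {0<..<p}" "crit_cubic a b c d x = 0" by blast
      have "y = x" if y: "y \<in> {0<..<p}" "crit_cubic a b c d y = 0" for y
        using uniq[OF x y] uniq[OF y x] by (cases x y rule: linorder_cases) auto
      then show ?thesis by blast
    qed blast
    then obtain x where sub: "{x\<in>{0<..<p}. crit_cubic a b c d x = 0} \<subseteq> {x}" by blast
    show "finite {x\<in>{0<..<p}. crit_cubic a b c d x = 0}" by (rule finite_subset[OF sub]) simp
    show "card {x\<in>{0<..<p}. crit_cubic a b c d x = 0} < 2" using card_mono[OF _ sub] by simp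
  qed (use p pq in auto)
  have "{x\<in>{0<..<1}. ?H x = 0} \<subseteq> {x\<in>{0<..<p}. ?H x = 0} \<union> {x\<in>{q<..<1}. ?H x = 0}"
  proof
    fix x assume x: "x \<in> {x\<in>{0<..<1}. ?H x = 0}"
    then have "lin a b x * lin c d x < 0" using crit_fun_zero_opposite_signs[OF AB] det by force
    then have "(s * w) * ((p - x) * (q - x)) > 0" by (simp add: lab lcd algebra_simps)
    then have "(p - x) * (q - x) > 0"
      using mult_pos_pos[OF sw] by (simp add: zero_less_mult_iff[of "s * w"])
    then show "x \<in> {x\<in>{0<..<p}. ?H x = 0} \<union> {x\<in>{q<..<1}. ?H x = 0}"
      using x pq by (auto simp: zero_less_mult_iff)
  qed
  then have "finite {x\<in>{0<..<1}. ?H x = 0}"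
    "card {x\<in>{0<..<1}. ?H x = 0} \<le> card {x\<in>{0<..<p}. ?H x = 0} + card {x\<in>{q<..<1}. ?H x = 0}"
    using left right by (meson finite_Un finite_subset card_Un_le card_mono order_trans)+
  then show ?thesis using left right unfolding fewer_zeros_def by auto
qed

lemma fewer_zeros_reflect:
  assumes "fewer_zeros (\<lambda>x. f (1 - x)) {0<..<1} n"
  shows "fewer_zeros f {0<..<1} n"
proof -
  have eq: "{x\<in>{0<..<1}. f x = 0} = (\<lambda>x. 1 - x) ` {x\<in>{0<..<1}. f (1 - x) = 0}"
    by (force simp: image_iff intro!: exI[of _ "1 - _"])
  have inj: "inj_on (\<lambda>x::real. 1 - x) {x\<in>{0<..<1}. f (1 - x) = 0}" by (simp add: inj_on_def)
  have all: "(\<forall>x\<in>{0<..<1}. f (1 - x) = 0) \<Longrightarrow> x \<in> {0<..<1} \<Longrightarrow> f x = 0" for x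
    by (drule bspec[of _ _ "1 - x"]) auto
  show ?thesis using assms all unfolding fewer_zeros_def eq
    by (metis (no_types, lifting) inj card_image finite_imageI)
qed

lemma beta_term_reflect: "beta_term a b (1 - x) = beta_term b a x"
  by (simp add: beta_term_def)

text \<open>
The reflection \<open>x \<mapsto> 1 - x\<close> exchanges the two exponents in each term and reverses the order
of the zeros of the linear factors.
\<close>

lemma fewer_zeros_two_sided:
  assumes sg: "a > 0" "b > 0" "c < 0" "d < 0" and det: "a * d \<noteq> b * c" and AB: "A * B > 0"
  shows "fewer_zeros (\<lambda>x. C + A * beta_term a b x + B * beta_term c d x) {0<..<1} 5"
proof (cases "a * d > b * c")
  case True
  then show ?thesis
    using fewer_zeros_of_crit_fun[OF fewer_zeros_crit_fun_two_sided[OF sg True AB]] by simp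
next
  case False
  then have "b * c > a * d" using det by simp
  from fewer_zeros_of_crit_fun[OF fewer_zeros_crit_fun_two_sided[OF sg(2,1,4,3) this AB]]
  have "fewer_zeros (\<lambda>x. C + A * beta_term b a x + B * beta_term d c x) {0<..<1} 5" by simp
  then show ?thesis
    using fewer_zeros_reflect[of "\<lambda>x. C + A * beta_term a b x + B * beta_term c d x" 5]
    by (simp add: beta_term_reflect)
qed

text \<open>
The region where the linear factors have opposite signs fails to be an interval only if one
exponent vector is positive and the other one negative.
\<close>

lemma fewer_zeros_three_beta_terms:
  assumes AB: "A * B > 0"
  shows "fewer_zeros (\<lambda>x. C + A * beta_term a b x + B * beta_term c d x) {0<..<1} 6"
proof -
  consider "a * d = b * c" | "a > 0" "b > 0" "c < 0" "d < 0" "a * d \<noteq> b * c"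
    | "c > 0" "d > 0" "a < 0" "b < 0" "a * d \<noteq> b * c"
    | "a * d \<noteq> b * c" "is_interval {x\<in>{0<..<1}. lin a b x * lin c d x < 0}"
    using opposite_signs_interval[of a b c d] by blast
  then show ?thesis
  proof cases
    case 1
    show ?thesis
      by (rule fewer_zeros_mono[OF fewer_zeros_of_crit_fun[OF fewer_zeros_crit_fun_parallel[OF 1]]]) simp
  next
    case 2
    show ?thesis by (rule fewer_zeros_mono[OF fewer_zeros_two_sided[OF 2 AB]]) simp
  next
    case 3
    then have "fewer_zeros (\<lambda>x. C + B * beta_term c d x + A * beta_term a b x) {0<..<1} 5"
      using fewer_zeros_two_sided[of c d a b B A C] AB by (simp add: mult.commute)
    then have "fewer_zeros (\<lambda>x. C + A * beta_term a b x + B * beta_term c d x) {0<..<1} 5"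
      by (simp add: algebra_simps)
    then show ?thesis by (rule fewer_zeros_mono) simp
  next
    case 4
    then show ?thesis
      using fewer_zeros_of_crit_fun[OF fewer_zeros_crit_fun_interval[OF AB 4]] by simp
  qed
qed

section \<open>Logarithmic coordinates and isolated roots\<close>

text \<open>
Logarithmic coordinates on the positive orthant: monomials become exponentials of linear forms.
\<close>

definition expv :: "real ^ 'n \<Rightarrow> real ^ 'n" where
  "expv w = (\<chi> i. exp (w $ i))"

lemma expv_in_pos_orthant [simp]: "expv w \<in> pos_orthant"
  by (simp add: expv_def pos_orthant_def)

lemma pos_orthant_expv:
  assumes "x \<in> pos_orthant"
  obtains w where "x = expv w"
proof
  show "x = expv (\<chi> i. ln (x $ i))"
    using assms by (simp add: expv_def pos_orthant_def vec_eq_iff)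
qed

lemma expv_eq_iff [simp]: "expv v = expv w \<longleftrightarrow> v = w"
  by (auto simp: expv_def vec_eq_iff)

lemma continuous_on_expv: "continuous_on S g \<Longrightarrow> continuous_on S (\<lambda>x. expv (g x))"
  unfolding expv_def by (intro continuous_intros)

lemma mono_val_expv: "mono_val a (expv w) = exp (a \<bullet> w)"
  by (simp add: mono_val_def expv_def inner_vec_def exp_sum powr_def)

lemma eval_fewnomial_expv:
  "eval_fewnomial f (expv w) = (\<Sum>a\<in>Poly_Mapping.keys f. Poly_Mapping.lookup f a * exp (a \<bullet> w))"
  by (simp add: eval_fewnomial_def mono_val_expv)

lemma pos_roots_2:
  fixes F :: "2 \<Rightarrow> 'n::finite fewnomial"
  shows "x \<in> pos_roots F \<longleftrightarrow>
    x \<in> pos_orthant \<and> eval_fewnomial (F 1) x = 0 \<and> eval_fewnomial (F 2) x = 0"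
  by (auto simp: pos_roots_def eval_system_def vec_eq_iff forall_2)

lemma is_arc_connected: "is_arc S \<Longrightarrow> connected S"
  unfolding is_arc_def
  by (elim disjE exE) (simp_all add: homeomorphic_connectedness connected_sphere)

text \<open>
A connected set with more than one point accumulates at each of its points.
\<close>

lemma isolated_root_if_not_limit_point:
  assumes "z \<in> pos_roots F" "\<not> z islimpt pos_roots F"
  shows "isolated_root F z"
  unfolding isolated_root_def
proof (intro conjI allI impI assms(1))
  fix S assume S: "is_arc S \<and> S \<subseteq> pos_roots F \<and> z \<in> S"
  then have "\<not> z islimpt S" using assms(2) islimpt_subset by blast
  then show "S = {z}" using connected_imp_perfect[of S z] is_arc_connected S by (metis singletonD)
qed

text \<open>
A compact piece of curve suffices, since an injective continuous map is a homeomorphism onto its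
image there.
\<close>

lemma not_isolated_on_curve:
  fixes s t :: real
  assumes "s < t" "continuous_on {s..t} \<gamma>" "inj_on \<gamma> {s..t}" "\<gamma> ` {s..t} \<subseteq> pos_roots F"
  shows "\<not> isolated_root F (\<gamma> s)"
proof
  assume iso: "isolated_root F (\<gamma> s)"
  have "{s..t} homeomorphic \<gamma> ` {s..t}"
    using assms by (intro homeomorphic_compact[where f = \<gamma>]) auto
  moreover have "{s..t} homeomorphic {0..1::real}"
    using homeomorphic_closed_intervals_real[OF assms(1), of 0 1] by simp
  ultimately have "is_arc (\<gamma> ` {s..t})"
    unfolding is_arc_def by (meson homeomorphic_sym homeomorphic_trans)
  then have "\<gamma> ` {s..t} = {\<gamma> s}"
    using iso assms unfolding isolated_root_def by auto
  moreover have "\<gamma> t \<in> \<gamma> ` {s..t}" using assms(1) by simp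
  ultimately have "\<gamma> t = \<gamma> s" by blast
  then show False using assms(1,3) by (auto dest: inj_onD)
qed

section \<open>Nondegenerate roots\<close>

text \<open>
The directional derivative in logarithmic coordinates.
\<close>

definition log_deriv :: "'n::finite fewnomial \<Rightarrow> real ^ 'n \<Rightarrow> real ^ 'n \<Rightarrow> real" where
  "log_deriv f w h = (\<Sum>a\<in>Poly_Mapping.keys f. Poly_Mapping.lookup f a * (exp (a \<bullet> w) * (a \<bullet> h)))"

lemma has_derivative_eval_expv:
  "((\<lambda>w. eval_fewnomial f (expv w)) has_derivative log_deriv f w) (at w)"
proof -
  have "((\<lambda>w. exp (a \<bullet> w)) has_derivative (\<lambda>h. exp (a \<bullet> w) * (a \<bullet> h))) (at w)" for a
    by (auto intro!: derivative_eq_intros)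
  then have "((\<lambda>w. \<Sum>a\<in>Poly_Mapping.keys f. Poly_Mapping.lookup f a * exp (a \<bullet> w)) has_derivative
    (\<lambda>h. \<Sum>a\<in>Poly_Mapping.keys f. Poly_Mapping.lookup f a * (exp (a \<bullet> w) * (a \<bullet> h)))) (at w)"
    by (rule has_derivative_sum[OF has_derivative_mult_right])
  then show ?thesis by (simp only: eval_fewnomial_expv log_deriv_def[abs_def])
qed

lemma expv_differentiable: "expv differentiable (at (w :: real ^ 'n))"
proof -
  have "(expv has_derivative (\<lambda>h. \<chi> i. exp (w $ i) * h $ i)) (at w)"
  proof (rule has_derivative_componentwise_within[THEN iffD2], rule ballI)
    fix b :: "real ^ 'n" assume "b \<in> Basis"
    then obtain i where b: "b = axis i 1" by (auto simp: Basis_vec_def)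
    have "((\<lambda>w::real^'n. exp (w $ i)) has_derivative (\<lambda>h. exp (w $ i) * h $ i)) (at w)"
      by (auto intro!: derivative_eq_intros bounded_linear.has_derivative[OF bounded_linear_vec_nth])
    then show "((\<lambda>x. expv x \<bullet> b) has_derivative (\<lambda>x. (\<chi> i. exp (w $ i) * x $ i) \<bullet> b)) (at w)"
      by (simp add: b expv_def inner_axis)
  qed
  then show ?thesis by (auto simp: differentiable_def)
qed

lemma eval_system_differentiable:
  fixes F :: "2 \<Rightarrow> 2 fewnomial"
  assumes x: "x \<in> pos_orthant"
  shows "eval_system F differentiable (at x)"
proof -
  have pw: "(\<lambda>x::real^2. x $ i powr c) differentiable (at x)" for i c
  proof -
    have "((\<lambda>y::real^2. y $ i) has_derivative (\<lambda>h. h $ i)) (at x)"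
      by (rule bounded_linear_imp_has_derivative) (rule bounded_linear_vec_nth)
    moreover have "((\<lambda>y. y powr c) has_real_derivative c * (x $ i) powr (c - 1)) (at (x $ i))"
      using x by (auto intro!: has_real_derivative_powr simp: pos_orthant_def)
    ultimately have "((\<lambda>y::real^2. (y $ i) powr c) has_derivative
        (\<lambda>h. c * (x $ i) powr (c - 1) * (h $ i))) (at x)"
      unfolding has_field_derivative_def
      using has_derivative_compose[of "\<lambda>y::real^2. y $ i" "\<lambda>h. h $ i" x UNIV "\<lambda>y. y powr c"] by simp
    then show ?thesis by (auto simp: differentiable_def)
  qed
  have "(\<lambda>x. eval_fewnomial f x) differentiable (at x)" for f :: "2 fewnomial"
    unfolding eval_fewnomial_def mono_val_def UNIV_2
    by (auto intro!: derivative_intros differentiable_sum differentiable_mult pw)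
  then have "\<forall>i. \<exists>D. ((\<lambda>x. eval_fewnomial (F i) x) has_derivative D) (at x)"
    unfolding differentiable_def by blast
  then obtain D where D: "\<And>i. ((\<lambda>x. eval_fewnomial (F i) x) has_derivative D i) (at x)"
    by metis
  have "(eval_system F has_derivative (\<lambda>h. \<chi> i. D i h)) (at x)"
  proof (rule has_derivative_componentwise_within[THEN iffD2], rule ballI)
    fix b :: "real ^ 2" assume "b \<in> Basis"
    then obtain i where b: "b = axis i 1" by (auto simp: Basis_vec_def)
    show "((\<lambda>x. eval_system F x \<bullet> b) has_derivative (\<lambda>h. (\<chi> i. D i h) \<bullet> b)) (at x)"
      using D[of i] by (simp add: b eval_system_def inner_axis)
  qed
  then show ?thesis by (auto simp: differentiable_def)
qed

text \<open>
The Jacobian is injective and hence expands lengths by some factor \<open>B > 0\<close> at least; the error of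
the linear approximation is smaller than half of this near \<open>z\<close>.
\<close>

lemma nondegenerate_imp_isolated:
  fixes F :: "2 \<Rightarrow> 2 fewnomial"
  assumes "nondegenerate_root F z"
  shows "isolated_root F z"
proof -
  have z: "z \<in> pos_roots F" and rk: "rank (jacobian (eval_system F) (at z)) = CARD(2)"
    using assms by (auto simp: nondegenerate_root_def)
  define J where "J = jacobian (eval_system F) (at z)"
  have J: "(eval_system F has_derivative (*v) J) (at z)"
    using eval_system_differentiable[of z F] z unfolding J_def jacobian_works pos_roots_def by auto
  have "inj ((*v) J)" using rk unfolding J_def[symmetric] full_rank_injective .
  then obtain B where B: "B > 0" "\<And>h. B * norm h \<le> norm (J *v h)"
    using linear_inj_bounded_below_pos[of "(*v) J"] by auto
  obtain d where d: "d > 0" "\<And>y. norm (y - z) < d \<Longrightarrow>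
      norm (eval_system F y - eval_system F z - J *v (y - z)) \<le> B / 2 * norm (y - z)"
    using J B(1) unfolding has_derivative_at_alt by (metis half_gt_zero)
  have "\<not> z islimpt pos_roots F"
  proof
    assume "z islimpt pos_roots F"
    then obtain y where y: "y \<in> pos_roots F" "y \<noteq> z" "dist y z < d"
      using d(1) unfolding islimpt_approachable by blast
    then have "norm (J *v (y - z)) \<le> B / 2 * norm (y - z)"
      using d(2)[of y] z by (simp add: pos_roots_def dist_norm)
    with B(2)[of "y - z"] have "B * norm (y - z) \<le> B / 2 * norm (y - z)" by linarith
    then show False using B(1) y(2) by simp
  qed
  then show ?thesis using isolated_root_if_not_limit_point z by blast
qed

text \<open>
A triangular criterion for surjectivity of the Jacobian, suited to a parametrised zero set: \<open>h\<^sub>1\<close> will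
be tangent to the zero set of the first equation and \<open>h\<^sub>2\<close> transversal to it.
\<close>

lemma nondegenerate_root_expv:
  fixes F :: "2 \<Rightarrow> 2 fewnomial"
  assumes root: "expv w \<in> pos_roots F"
    and h1: "log_deriv (F 1) w h1 = 0" "log_deriv (F 2) w h1 \<noteq> 0"
    and h2: "log_deriv (F 1) w h2 \<noteq> 0"
  shows "nondegenerate_root F (expv w)"
proof -
  define J where "J = jacobian (eval_system F) (at (expv w))"
  have J: "(eval_system F has_derivative (*v) J) (at (expv w))"
    using eval_system_differentiable[of "expv w" F] unfolding J_def jacobian_works by auto
  obtain E where E: "(expv has_derivative E) (at w)"
    using expv_differentiable by (auto simp: differentiable_def)
  have "((\<lambda>w. eval_system F (expv w)) has_derivative (\<lambda>h. J *v E h)) (at w)"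
    using has_derivative_compose[OF E J] by simp
  then have "((\<lambda>w. eval_system F (expv w) $ i) has_derivative (\<lambda>h. (J *v E h) $ i)) (at w)" for i
    by (rule bounded_linear.has_derivative[OF bounded_linear_vec_nth])
  then have JE: "(J *v E h) $ i = log_deriv (F i) w h" for i h
    using has_derivative_unique[OF _ has_derivative_eval_expv[of "F i" w]]
    by (simp add: eval_system_def) metis
  have "surj ((*v) J)"
  proof (rule surjI)
    fix y :: "real ^ 2"
    let ?s = "y $ 1 / log_deriv (F 1) w h2"
    let ?t = "(y $ 2 - ?s * log_deriv (F 2) w h2) / log_deriv (F 2) w h1"
    show "J *v (?s *\<^sub>R E h2 + ?t *\<^sub>R E h1) = y"
      using h1 h2 by (simp add: vec_eq_iff forall_2 matrix_vector_right_distrib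
        matrix_vector_mult_scaleR JE)
  qed
  then have "rank J = CARD(2)" unfolding full_rank_surjective[symmetric] .
  then show ?thesis using root by (simp add: nondegenerate_root_def J_def)
qed

section \<open>Trinomials with collinear exponents\<close>

text \<open>
Exponentials with distinct frequencies are linearly independent; the argument is the same as for
counting zeros.
\<close>

lemma exp_sum_eq_0:
  assumes "finite K" "\<And>t. (\<Sum>k\<in>K. c k * exp (k * t)) = 0"
  shows "\<forall>k\<in>K. c k = (0::real)"
  using assms
proof (induction K arbitrary: c)
  case (insert a K)
  have g: "c a + (\<Sum>k\<in>K. c k * exp ((k - a) * t)) = 0" for t
  proof -
    have "exp (a * t) * (c a + (\<Sum>k\<in>K. c k * exp ((k - a) * t))) = (\<Sum>k\<in>insert a K. c k * exp (k * t))"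
      using insert.hyps by (simp add: sum_distrib_left distrib_left algebra_simps flip: exp_add)
    then show ?thesis using insert.prems by simp
  qed
  have "(\<Sum>k\<in>K. (c k * (k - a)) * exp (k * t)) = 0" for t
  proof -
    have "((\<lambda>t. c a + (\<Sum>k\<in>K. c k * exp ((k - a) * t))) has_real_derivative
        (\<Sum>k\<in>K. (c k * (k - a)) * exp ((k - a) * t))) (at t)"
      by (auto intro!: derivative_eq_intros sum.cong)
    then have "(\<Sum>k\<in>K. (c k * (k - a)) * exp ((k - a) * t)) = 0"
      unfolding g by (metis DERIV_const DERIV_unique)
    moreover have "exp (a * t) * (\<Sum>k\<in>K. (c k * (k - a)) * exp ((k - a) * t))
        = (\<Sum>k\<in>K. (c k * (k - a)) * exp (k * t))"
      by (simp add: sum_distrib_left algebra_simps flip: exp_add)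
    ultimately show ?thesis by simp
  qed
  from insert.IH[OF this] have "\<forall>k\<in>K. c k = 0" using insert.hyps by auto
  then show ?case using g[of 0] by simp
qed simp

text \<open>
The line \<open>v \<bullet> w = \<tau>\<close>, parametrised in the direction orthogonal to \<open>v\<close>.
\<close>

definition line_pt :: "real ^ 2 \<Rightarrow> real \<Rightarrow> real \<Rightarrow> real ^ 2" where
  "line_pt v \<tau> s = (\<tau> / (v \<bullet> v)) *\<^sub>R v + s *\<^sub>R vector [- (v $ 2), v $ 1]"

lemma line_pt_exists:
  assumes "v \<noteq> 0" "v \<bullet> w = \<tau>"
  shows "\<exists>s. w = line_pt v \<tau> s"
proof
  let ?v' = "vector [- (v $ 2), v $ 1] :: real ^ 2"
  have "(v \<bullet> v) *\<^sub>R w = (v \<bullet> w) *\<^sub>R v + (?v' \<bullet> w) *\<^sub>R ?v'"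
    by (simp add: vec_eq_iff forall_2 inner_vec_def sum_2 algebra_simps)
  then have "(1 / (v \<bullet> v)) *\<^sub>R ((v \<bullet> v) *\<^sub>R w)
      = (1 / (v \<bullet> v)) *\<^sub>R ((v \<bullet> w) *\<^sub>R v + (?v' \<bullet> w) *\<^sub>R ?v')" by simp
  then show "w = line_pt v \<tau> ((?v' \<bullet> w) / (v \<bullet> v))"
    using assms by (simp add: line_pt_def scaleR_add_right)
qed

lemma inner_line_pt:
  assumes "v \<noteq> 0"
  shows "v \<bullet> line_pt v \<tau> s = \<tau>"
  using assms by (simp add: line_pt_def inner_add_right) (simp add: inner_vec_def sum_2)

lemma line_pt_eq_iff:
  assumes "v \<noteq> 0"
  shows "line_pt v \<tau> s = line_pt v \<tau> t \<longleftrightarrow> s = t"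
  using assms by (auto simp: line_pt_def vec_eq_iff forall_2)

text \<open>
Up to a monomial factor, the first equation is an exponential sum \<open>\<phi>\<close> with three terms in
\<open>v \<bullet> w\<close>, so its zero set is a union of at most two lines.
\<close>

lemma isolated_collinear:
  fixes F :: "2 \<Rightarrow> 2 fewnomial"
  assumes keys: "Poly_Mapping.keys (F 1) = {a, a + v, a + t *\<^sub>R v}"
    and v: "v \<noteq> 0" and t: "t \<noteq> 0" "t \<noteq> 1"
    and m: "card (Poly_Mapping.keys (F 2)) \<ge> 1"
  shows "finite {z. isolated_root F z} \<and>
    card {z. isolated_root F z} \<le> 2 * (card (Poly_Mapping.keys (F 2)) - 1)"
proof -
  let ?c = "\<lambda>k. Poly_Mapping.lookup (F 1) (a + k *\<^sub>R v)"
  let ?\<phi> = "\<lambda>\<tau>. \<Sum>k\<in>{0, 1, t}. ?c k * exp (k * \<tau>)"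
  define Z where "Z = {\<tau>. ?\<phi> \<tau> = 0}"
  let ?m = "card (Poly_Mapping.keys (F 2))"
  let ?cg = "\<lambda>\<tau> b. Poly_Mapping.lookup (F 2) b * exp (b \<bullet> ((\<tau> / (v \<bullet> v)) *\<^sub>R v))"
  let ?G = "\<lambda>\<tau> s. \<Sum>b\<in>Poly_Mapping.keys (F 2). ?cg \<tau> b * exp ((b \<bullet> vector [- (v $ 2), v $ 1]) * s)"
  have f: "eval_fewnomial (F 1) (expv w) = exp (a \<bullet> w) * ?\<phi> (v \<bullet> w)" for w
  proof -
    have inj: "inj_on (\<lambda>k. a + k *\<^sub>R v) {0, 1, t}" using v by (auto simp: inj_on_def)
    have "Poly_Mapping.keys (F 1) = (\<lambda>k. a + k *\<^sub>R v) ` {0, 1, t}" by (simp add: keys)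
    then have "eval_fewnomial (F 1) (expv w) = (\<Sum>k\<in>{0, 1, t}. ?c k * exp ((a + k *\<^sub>R v) \<bullet> w))"
      unfolding eval_fewnomial_expv by (intro sum.reindex_cong[OF inj]) auto
    then show ?thesis
      unfolding sum_distrib_left by (simp add: inner_add_left exp_add mult.left_commute)
  qed
  have Z: "finite Z" "card Z \<le> 2"
  proof -
    have "\<not> (\<forall>\<tau>. ?\<phi> \<tau> = 0)"
    proof
      assume "\<forall>\<tau>. ?\<phi> \<tau> = 0"
      then have "\<forall>k\<in>{0, 1, t}. ?c k = 0" by (intro exp_sum_eq_0) auto
      then have "Poly_Mapping.lookup (F 1) a = 0" by simp
      moreover have "a \<in> Poly_Mapping.keys (F 1)" by (simp add: keys)
      ultimately show False by (simp add: in_keys_iff)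
    qed
    then show "finite Z" "card Z \<le> 2"
      using fewer_zeros_exp_sum[of "{0, 1, t}" ?c "\<lambda>k. k"] t
      unfolding fewer_zeros_def Z_def by (auto simp: numeral_3_eq_3)
  qed
  have g: "eval_fewnomial (F 2) (expv (line_pt v \<tau> s)) = ?G \<tau> s" for \<tau> s
    unfolding eval_fewnomial_expv line_pt_def
    by (simp add: inner_add_right exp_add algebra_simps)
  define I where "I \<tau> = {z. isolated_root F z \<and> (\<exists>s. z = expv (line_pt v \<tau> s))}" for \<tau>
  have I: "finite (I \<tau>) \<and> card (I \<tau>) \<le> ?m - 1" if \<tau>: "\<tau> \<in> Z" for \<tau>
  proof -
    have rootI: "expv (line_pt v \<tau> s) \<in> pos_roots F \<longleftrightarrow> ?G \<tau> s = 0" for s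
      using \<tau> unfolding pos_roots_2 f g inner_line_pt[OF v] Z_def by simp
    consider "\<forall>s. ?G \<tau> s = 0" | "finite {s. ?G \<tau> s = 0}" "card {s. ?G \<tau> s = 0} < ?m"
      using fewer_zeros_exp_sum[of "Poly_Mapping.keys (F 2)" "?cg \<tau>" "\<lambda>b. b \<bullet> vector [- (v $ 2), v $ 1]"]
      unfolding fewer_zeros_def by auto
    then show ?thesis
    proof cases
      case 1
      have "\<not> isolated_root F (expv (line_pt v \<tau> s))" for s
      proof (rule not_isolated_on_curve[of s "s + 1"])
        show "continuous_on {s..s + 1} (\<lambda>s. expv (line_pt v \<tau> s))"
          unfolding line_pt_def by (intro continuous_on_expv continuous_intros)
        show "inj_on (\<lambda>s. expv (line_pt v \<tau> s)) {s..s + 1}"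
          by (simp add: inj_on_def line_pt_eq_iff[OF v])
        show "(\<lambda>s. expv (line_pt v \<tau> s)) ` {s..s + 1} \<subseteq> pos_roots F" using rootI 1 by auto
      qed simp
      then have "I \<tau> = {}" by (auto simp: I_def)
      then show ?thesis by simp
    next
      case 2
      have "I \<tau> \<subseteq> (\<lambda>s. expv (line_pt v \<tau> s)) ` {s. ?G \<tau> s = 0}"
        using rootI by (auto simp: I_def isolated_root_def)
      then have "finite (I \<tau>)" "card (I \<tau>) \<le> card {s. ?G \<tau> s = 0}"
        using 2(1) by (meson finite_imageI finite_subset surj_card_le)+
      then show ?thesis using 2(2) by linarith
    qed
  qed
  have "{z. isolated_root F z} \<subseteq> (\<Union>\<tau>\<in>Z. I \<tau>)"
  proof
    fix z assume "z \<in> {z. isolated_root F z}"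
    then have iso: "isolated_root F z" by simp
    then have z: "z \<in> pos_roots F" by (simp add: isolated_root_def)
    then obtain w where w: "z = expv w" using pos_orthant_expv by (auto simp: pos_roots_2)
    then have "v \<bullet> w \<in> Z" using z by (simp add: pos_roots_2 f Z_def)
    moreover have "z \<in> I (v \<bullet> w)" using line_pt_exists[OF v refl, of w] w iso by (auto simp: I_def)
    ultimately show "z \<in> (\<Union>\<tau>\<in>Z. I \<tau>)" by blast
  qed
  moreover have "finite (\<Union>\<tau>\<in>Z. I \<tau>)" using Z I by blast
  moreover have "card (\<Union>\<tau>\<in>Z. I \<tau>) \<le> 2 * (?m - 1)"
  proof -
    have "card (\<Union>\<tau>\<in>Z. I \<tau>) \<le> (\<Sum>\<tau>\<in>Z. card (I \<tau>))" using Z(1) by (rule card_UN_le)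
    also have "\<dots> \<le> card Z * (?m - 1)" using I by (intro sum_bounded_above[THEN order_trans]) auto
    also have "\<dots> \<le> 2 * (?m - 1)" using Z(2) by simp
    finally show ?thesis .
  qed
  ultimately show ?thesis by (meson card_mono finite_subset le_trans)
qed

section \<open>Simple solutions of a nearby equation\<close>

lemma level_near_zero_left:
  fixes R :: "real \<Rightarrow> real"
  assumes "continuous_on {l..z} R" "l < z" "R z = 0" "0 < \<epsilon>" "\<epsilon> < R l"
  shows "\<exists>x. l < x \<and> x < z \<and> R x = \<epsilon>"
proof -
  obtain x where x: "l \<le> x" "x \<le> z" "R x = \<epsilon>"
    using IVT2'[of R z \<epsilon> l] assms by auto
  moreover have "x \<noteq> l" "x \<noteq> z" using x(3) assms by auto
  ultimately show ?thesis by (intro exI[of _ x]) auto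
qed

lemma level_near_zero_right:
  fixes R :: "real \<Rightarrow> real"
  assumes "continuous_on {z..r} R" "z < r" "R z = 0" "0 < \<epsilon>" "\<epsilon> < R r"
  shows "\<exists>x. z < x \<and> x < r \<and> R x = \<epsilon>"
proof -
  obtain x where x: "z \<le> x" "x \<le> r" "R x = \<epsilon>"
    using IVT'[of R z \<epsilon> r] assms by auto
  moreover have "x \<noteq> r" "x \<noteq> z" using x(3) assms by auto
  ultimately show ?thesis by (intro exI[of _ x]) auto
qed

text \<open>
The intervals of radius \<open>e\<close> around the zeros are disjoint.  Each half of such an interval at whose
outer end \<open>R\<close> is positive contains a solution of \<open>R = \<epsilon>\<close>, by the intermediate value theorem.
\<close>

lemma many_solutions_positive_levels:
  fixes R :: "real \<Rightarrow> real"
  assumes cont: "continuous_on {0<..<1} R" and Z: "finite Z" "\<And>z. z \<in> Z \<Longrightarrow> R z = 0"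
    and e: "e > 0" "\<And>z. z \<in> Z \<Longrightarrow> 0 < z - e \<and> z + e < 1"
    and sep: "\<And>z z'. z \<in> Z \<Longrightarrow> z' \<in> Z \<Longrightarrow> z < z' \<Longrightarrow> z + e < z' - e"
  shows "\<exists>\<delta>>0. \<forall>\<epsilon>. 0 < \<epsilon> \<and> \<epsilon> < \<delta> \<longrightarrow> (\<exists>X. finite X \<and> X \<subseteq> {x\<in>{0<..<1}. R x = \<epsilon>} \<and>
    card X = card {z\<in>Z. R (z - e) > 0} + card {z\<in>Z. R (z + e) > 0})"
proof -
  define P Q where "P = {z\<in>Z. R (z - e) > 0}" and "Q = {z\<in>Z. R (z + e) > 0}"
  have fin: "finite P" "finite Q" using Z(1) by (auto simp: P_def Q_def)
  define \<delta> where "\<delta> = Min (insert 1 ((\<lambda>z. R (z - e)) ` P \<union> (\<lambda>z. R (z + e)) ` Q))"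
  have "\<delta> > 0" using fin by (auto simp: \<delta>_def P_def Q_def)
  moreover have "\<exists>X. finite X \<and> X \<subseteq> {x\<in>{0<..<1}. R x = \<epsilon>} \<and> card X = card P + card Q"
    if \<epsilon>: "0 < \<epsilon> \<and> \<epsilon> < \<delta>" for \<epsilon>
  proof -
    have "\<exists>x. z - e < x \<and> x < z \<and> R x = \<epsilon>" if z: "z \<in> P" for z
    proof (rule level_near_zero_left)
      show "continuous_on {z - e..z} R"
        using e(1) e(2)[of z] z by (intro continuous_on_subset[OF cont]) (auto simp: P_def)
      have "\<delta> \<le> R (z - e)" unfolding \<delta>_def using fin z by (intro Min_le) auto
      then show "\<epsilon> < R (z - e)" using \<epsilon> by linarith
    qed (use z Z e \<epsilon> in \<open>auto simp: P_def\<close>)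
    then obtain f where f: "\<And>z. z \<in> P \<Longrightarrow> z - e < f z \<and> f z < z \<and> R (f z) = \<epsilon>" by metis
    have "\<exists>x. z < x \<and> x < z + e \<and> R x = \<epsilon>" if z: "z \<in> Q" for z
    proof (rule level_near_zero_right)
      show "continuous_on {z..z + e} R"
        using e(1) e(2)[of z] z by (intro continuous_on_subset[OF cont]) (auto simp: Q_def)
      have "\<delta> \<le> R (z + e)" unfolding \<delta>_def using fin z by (intro Min_le) auto
      then show "\<epsilon> < R (z + e)" using \<epsilon> by linarith
    qed (use z Z e \<epsilon> in \<open>auto simp: Q_def\<close>)
    then obtain g where g: "\<And>z. z \<in> Q \<Longrightarrow> z < g z \<and> g z < z + e \<and> R (g z) = \<epsilon>" by metis
    have Zs: "P \<subseteq> Z" "Q \<subseteq> Z" by (auto simp: P_def Q_def)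
    have same: "z = z'" if "z \<in> Z" "z' \<in> Z" "z - e < x" "x < z + e" "z' - e < x" "x < z' + e" for z z' x
      using sep[of z z'] sep[of z' z] that by (cases z z' rule: linorder_cases) auto
    have "inj_on f P"
    proof (rule inj_onI)
      fix z z' assume *: "z \<in> P" "z' \<in> P" "f z = f z'"
      show "z = z'" using same[of z z' "f z"] f[of z] f[of z'] * Zs e(1) by auto
    qed
    moreover have "inj_on g Q"
    proof (rule inj_onI)
      fix z z' assume *: "z \<in> Q" "z' \<in> Q" "g z = g z'"
      show "z = z'" using same[of z z' "g z"] g[of z] g[of z'] * Zs e(1) by auto
    qed
    moreover have "f z \<noteq> g z'" if "z \<in> P" "z' \<in> Q" for z z'
    proof
      assume eq: "f z = g z'"
      have "z = z'"
        by (rule same[of z z' "f z"]) (use f[of z] g[of z'] that Zs e(1) eq in auto)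
      then show False using f[of z] g[of z'] that eq by auto
    qed
    then have "f ` P \<inter> g ` Q = {}" by blast
    ultimately have "card (f ` P \<union> g ` Q) = card P + card Q"
      using fin by (simp add: card_Un_disjoint card_image)
    moreover have "f ` P \<union> g ` Q \<subseteq> {x\<in>{0<..<1}. R x = \<epsilon>}"
    proof -
      have "f z \<in> {x\<in>{0<..<1}. R x = \<epsilon>}" if "z \<in> P" for z
        using f[OF that] e(1) e(2)[of z] that Zs by auto
      moreover have "g z \<in> {x\<in>{0<..<1}. R x = \<epsilon>}" if "z \<in> Q" for z
        using g[OF that] e(1) e(2)[of z] that Zs by auto
      ultimately show ?thesis by blast
    qed
    ultimately show ?thesis using fin by (intro exI[of _ "f ` P \<union> g ` Q"]) auto
  qed
  ultimately show ?thesis unfolding P_def Q_def by blast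
qed

text \<open>
A third of the smallest gap in \<open>Z \<union> {0, 1}\<close>.  The element \<open>1\<close> put into the set of gaps is itself
the gap between \<open>0\<close> and \<open>1\<close>, so it does not change the minimum.
\<close>

lemma separating_radius:
  fixes Z :: "real set"
  assumes "finite Z" "Z \<subseteq> {0<..<1}"
  obtains e where "e > 0" "\<And>z. z \<in> Z \<Longrightarrow> 0 < z - e \<and> z + e < 1"
    "\<And>z z'. z \<in> Z \<Longrightarrow> z' \<in> Z \<Longrightarrow> z < z' \<Longrightarrow> z + e < z' - e"
proof -
  define D where "D = insert 1 ((\<lambda>(z, z'). z' - z) ` {(z, z') \<in> insert 0 (insert 1 Z) \<times> insert 0 (insert 1 Z). z < z'})"
  have "finite (insert 0 (insert 1 Z) \<times> insert 0 (insert 1 Z))" using assms(1) by simp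
  then have "finite {(z, z') \<in> insert 0 (insert 1 Z) \<times> insert 0 (insert 1 Z). z < z'}"
    by (rule rev_finite_subset) auto
  then have fin: "finite D" unfolding D_def by simp
  have pos: "Min D > 0" using fin by (auto simp: D_def)
  have gap: "Min D \<le> z' - z" if "z \<in> insert 0 (insert 1 Z)" "z' \<in> insert 0 (insert 1 Z)" "z < z'" for z z'
  proof -
    have "(z, z') \<in> {(z, z') \<in> insert 0 (insert 1 Z) \<times> insert 0 (insert 1 Z). z < z'}"
      using that by auto
    then have "z' - z \<in> D" unfolding D_def by (intro insertI2 image_eqI[of _ _ "(z, z')"]) auto
    then show ?thesis by (rule Min_le[OF fin])
  qed
  show thesis
  proof (rule that[of "Min D / 3"])
    show "0 < z - Min D / 3 \<and> z + Min D / 3 < 1" if "z \<in> Z" for z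
      using gap[of 0 z] gap[of z 1] pos that assms(2) by (auto simp: subset_iff)
    show "z + Min D / 3 < z' - Min D / 3" if "z \<in> Z" "z' \<in> Z" "z < z'" for z z'
      using gap[of z z'] pos that by auto
  qed (use pos in simp)
qed

text \<open>
The half-neighbourhoods of the zeros are twice as many as the zeros; hence those where \<open>R\<close> is
positive, or those where it is negative, are at least as many as the zeros.
\<close>

lemma many_solutions_nearby_level:
  fixes R :: "real \<Rightarrow> real"
  assumes cont: "continuous_on {0<..<1} R" and fin: "finite {x\<in>{0<..<1}. R x = 0}"
  shows "\<exists>s\<in>{1, -1}. \<exists>\<delta>>0. \<forall>\<epsilon>. 0 < \<epsilon> \<and> \<epsilon> < \<delta> \<longrightarrow>
    (\<exists>X. finite X \<and> X \<subseteq> {x\<in>{0<..<1}. R x = s * \<epsilon>} \<and> card X = card {x\<in>{0<..<1}. R x = 0})"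
proof -
  define Z where "Z = {x\<in>{0<..<1}. R x = 0}"
  have Zf: "finite Z" "Z \<subseteq> {0<..<1}" using fin by (auto simp: Z_def)
  obtain e where e: "e > 0" "\<And>z. z \<in> Z \<Longrightarrow> 0 < z - e \<and> z + e < 1"
    and sep: "\<And>z z'. z \<in> Z \<Longrightarrow> z' \<in> Z \<Longrightarrow> z < z' \<Longrightarrow> z + e < z' - e"
    by (rule separating_radius[OF Zf]) blast
  have nz: "R (z - e) \<noteq> 0" "R (z + e) \<noteq> 0" if "z \<in> Z" for z
  proof -
    have "z - e \<notin> Z" using sep[of "z - e" z] that e(1) by auto
    then show "R (z - e) \<noteq> 0" using e(2)[OF that] e(1) by (auto simp: Z_def)
    have "z + e \<notin> Z" using sep[of z "z + e"] that e(1) by auto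
    then show "R (z + e) \<noteq> 0" using e(2)[OF that] e(1) by (auto simp: Z_def)
  qed
  have finZ: "finite Z" using fin by (simp add: Z_def)
  \<comment> \<open>the number of half-neighbourhoods on which \<open>R\<close> has the sign \<open>s\<close>\<close>
  define n where "n s = card {z\<in>Z. s * R (z - e) > 0} + card {z\<in>Z. s * R (z + e) > 0}" for s :: real
  have split: "card {z\<in>Z. 1 * h z > 0} + card {z\<in>Z. -1 * h z > 0} = card Z"
    if "\<And>z. z \<in> Z \<Longrightarrow> h z \<noteq> 0" for h :: "real \<Rightarrow> real"
  proof -
    have "{z\<in>Z. 1 * h z > 0} \<union> {z\<in>Z. -1 * h z > 0} = Z" using that by fastforce
    moreover have "{z\<in>Z. 1 * h z > 0} \<inter> {z\<in>Z. -1 * h z > 0} = {}" by auto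
    ultimately show ?thesis using finZ by (metis card_Un_disjoint finite_Un)
  qed
  have "n 1 + n (-1) = 2 * card Z"
    using split[of "\<lambda>z. R (z - e)"] split[of "\<lambda>z. R (z + e)"] nz unfolding n_def by simp
  then have "n 1 \<ge> card Z \<or> n (-1) \<ge> card Z" by linarith
  then obtain s where s: "s \<in> {1, -1}" "n s \<ge> card Z" by blast
  have "continuous_on {0<..<1} (\<lambda>x. s * R x)" using cont by (intro continuous_intros)
  then have "\<exists>\<delta>>0. \<forall>\<epsilon>. 0 < \<epsilon> \<and> \<epsilon> < \<delta> \<longrightarrow>
      (\<exists>X. finite X \<and> X \<subseteq> {x\<in>{0<..<1}. s * R x = \<epsilon>} \<and> card X = n s)"
    unfolding n_def by (rule many_solutions_positive_levels[OF _ finZ _ e sep]) (auto simp: Z_def)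
  then obtain \<delta> where \<delta>: "\<delta> > 0" "\<And>\<epsilon>. 0 < \<epsilon> \<and> \<epsilon> < \<delta> \<Longrightarrow>
      \<exists>X. finite X \<and> X \<subseteq> {x\<in>{0<..<1}. s * R x = \<epsilon>} \<and> card X = n s"
    by blast
  have "\<exists>X. finite X \<and> X \<subseteq> {x\<in>{0<..<1}. R x = s * \<epsilon>} \<and> card X = card Z" if \<epsilon>: "0 < \<epsilon> \<and> \<epsilon> < \<delta>" for \<epsilon>
  proof -
    obtain X where "finite X" "X \<subseteq> {x\<in>{0<..<1}. s * R x = \<epsilon>}" "card X = n s" using \<delta>(2)[OF \<epsilon>] by blast
    moreover have "{x\<in>{0<..<1}. s * R x = \<epsilon>} = {x\<in>{0<..<1}. R x = s * \<epsilon>}" using s(1) by auto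
    ultimately show ?thesis using s(2) by (metis finite_subset obtain_subset_with_card_n subset_trans)
  qed
  then show ?thesis using s(1) \<delta>(1) unfolding Z_def by blast
qed

text \<open>
The excluded value \<open>c\<close> will be the coefficient that is perturbed: the perturbation must not
cancel it.
\<close>

lemma regular_level_with_many_solutions:
  fixes R :: "real \<Rightarrow> real"
  assumes cont: "continuous_on {0<..<1} R" and fin: "finite {x\<in>{0<..<1}. R x = 0}"
    and crit: "finite {x\<in>{0<..<1}. R' x = 0}" and c: "c \<noteq> 0"
  obtains \<epsilon> X where "\<epsilon> \<noteq> c" "finite X" "card X = card {x\<in>{0<..<1}. R x = 0}"
    "\<And>x. x \<in> X \<Longrightarrow> x \<in> {0<..<1} \<and> R x = \<epsilon> \<and> R' x \<noteq> 0"
proof -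
  obtain s \<delta> where s: "s \<in> {1, -1}" and \<delta>: "\<delta> > 0" "\<And>\<epsilon>. 0 < \<epsilon> \<and> \<epsilon> < \<delta> \<Longrightarrow>
    \<exists>X. finite X \<and> X \<subseteq> {x\<in>{0<..<1}. R x = s * \<epsilon>} \<and> card X = card {x\<in>{0<..<1}. R x = 0}"
    using many_solutions_nearby_level[OF cont fin] by blast
  \<comment> \<open>the critical values and \<open>c\<close> are finitely many values to avoid\<close>
  have "infinite ({0<..<\<delta>} - ((\<lambda>x. R x / s) ` {x\<in>{0<..<1}. R' x = 0} \<union> {c / s}))"
    using \<delta>(1) crit by (simp add: infinite_Ioo Diff_infinite_finite)
  then obtain \<epsilon> where "\<epsilon> \<in> {0<..<\<delta>} - ((\<lambda>x. R x / s) ` {x\<in>{0<..<1}. R' x = 0} \<union> {c / s})"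
    using infinite_imp_nonempty by blast
  then have \<epsilon>: "0 < \<epsilon>" "\<epsilon> < \<delta>" "\<epsilon> \<noteq> c / s" "\<epsilon> \<notin> (\<lambda>x. R x / s) ` {x\<in>{0<..<1}. R' x = 0}"
    by simp_all
  obtain X where X: "finite X" "X \<subseteq> {x\<in>{0<..<1}. R x = s * \<epsilon>}" "card X = card {x\<in>{0<..<1}. R x = 0}"
    using \<delta>(2)[of \<epsilon>] \<epsilon>(1,2) by auto
  show thesis
  proof (rule that[of "s * \<epsilon>" X])
    show "s * \<epsilon> \<noteq> c" using \<epsilon>(3) s by auto
    fix x assume "x \<in> X"
    then have x: "x \<in> {0<..<1}" "R x = s * \<epsilon>" using X(2) by auto
    moreover have "R' x \<noteq> 0"
    proof
      assume "R' x = 0"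
      then have "R x / s \<in> (\<lambda>x. R x / s) ` {x\<in>{0<..<1}. R' x = 0}" using x by blast
      moreover have "R x / s = \<epsilon>" using x(2) s by auto
      ultimately show False using \<epsilon>(4) by simp
    qed
    ultimately show "x \<in> {0<..<1} \<and> R x = s * \<epsilon> \<and> R' x \<noteq> 0" by blast
  qed (use X in auto)
qed

section \<open>Trinomials with affinely independent exponents\<close>

text \<open>
A trinomial in which \<open>a\<^sub>0\<close> carries the exceptional sign.  The vectors \<open>e\<^sub>1, e\<^sub>2\<close> form the basis dual to
\<open>a\<^sub>1 - a\<^sub>0, a\<^sub>2 - a\<^sub>0\<close>; the coordinates of \<open>w\<close> with respect to it are the logarithms of the quotients of
the monomials.
\<close>

locale normal_trinomial =
  fixes f :: "2 fewnomial" and a0 a1 a2 e1 e2 :: "real ^ 2"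
  assumes keys: "Poly_Mapping.keys f = {a0, a1, a2}"
    and signs: "Poly_Mapping.lookup f a0 * Poly_Mapping.lookup f a1 < 0"
      "Poly_Mapping.lookup f a0 * Poly_Mapping.lookup f a2 < 0"
    and dual: "(a1 - a0) \<bullet> e1 = 1" "(a1 - a0) \<bullet> e2 = 0" "(a2 - a0) \<bullet> e1 = 0" "(a2 - a0) \<bullet> e2 = 1"
    and span: "w = ((a1 - a0) \<bullet> w) *\<^sub>R e1 + ((a2 - a0) \<bullet> w) *\<^sub>R e2"
begin

definition "shift1 = ln (- Poly_Mapping.lookup f a1 / Poly_Mapping.lookup f a0)"
definition "shift2 = ln (- Poly_Mapping.lookup f a2 / Poly_Mapping.lookup f a0)"

text \<open>
The point at which the terms at \<open>a\<^sub>1\<close> and \<open>a\<^sub>2\<close>, divided by the negative of the term at \<open>a\<^sub>0\<close>, have the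
values \<open>u\<close> and \<open>1 - u\<close>.
\<close>

definition log_curve :: "real \<Rightarrow> real ^ 2" where
  "log_curve u = (ln u - shift1) *\<^sub>R e1 + (ln (1 - u) - shift2) *\<^sub>R e2"

definition weight :: "real ^ 2 \<Rightarrow> real" where
  "weight a = exp (- (shift1 * (a \<bullet> e1)) - shift2 * (a \<bullet> e2))"

definition restr :: "2 fewnomial \<Rightarrow> real \<Rightarrow> real" where
  "restr g u = (\<Sum>a\<in>Poly_Mapping.keys g.
     Poly_Mapping.lookup g a * weight a * beta_term (a \<bullet> e1) (a \<bullet> e2) u)"

lemma weight_pos: "weight a > 0"
  by (simp add: weight_def)

lemma exponents_distinct: "a0 \<noteq> a1" "a0 \<noteq> a2" "a1 \<noteq> a2"
  using dual by auto

lemma sum_keys: "sum h (Poly_Mapping.keys f) = h a0 + h a1 + h a2"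
  using exponents_distinct by (simp add: keys add.assoc)

lemma coeffs:
  "Poly_Mapping.lookup f a1 = - Poly_Mapping.lookup f a0 * exp shift1"
  "Poly_Mapping.lookup f a2 = - Poly_Mapping.lookup f a0 * exp shift2"
  "Poly_Mapping.lookup f a0 \<noteq> 0"
proof -
  have "- Poly_Mapping.lookup f a1 / Poly_Mapping.lookup f a0 > 0"
    "- Poly_Mapping.lookup f a2 / Poly_Mapping.lookup f a0 > 0"
    using signs by (auto simp: zero_less_divide_iff mult_less_0_iff divide_less_0_iff)
  then show "Poly_Mapping.lookup f a1 = - Poly_Mapping.lookup f a0 * exp shift1"
    "Poly_Mapping.lookup f a2 = - Poly_Mapping.lookup f a0 * exp shift2"
    by (auto simp: shift1_def shift2_def)
  show "Poly_Mapping.lookup f a0 \<noteq> 0" using signs by auto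
qed

lemma eval_expv_eq_0_iff:
  "eval_fewnomial f (expv w) = 0 \<longleftrightarrow> exp ((a1 - a0) \<bullet> w + shift1) + exp ((a2 - a0) \<bullet> w + shift2) = 1"
proof -
  have "eval_fewnomial f (expv w) = Poly_Mapping.lookup f a0 * exp (a0 \<bullet> w)
      * (1 - (exp ((a1 - a0) \<bullet> w + shift1) + exp ((a2 - a0) \<bullet> w + shift2)))"
    unfolding eval_fewnomial_expv sum_keys coeffs(1,2)
    by (simp add: inner_diff_left algebra_simps flip: exp_add)
  then show ?thesis using coeffs(3) by auto
qed

lemma inner_log_curve:
  "(a1 - a0) \<bullet> log_curve u = ln u - shift1" "(a2 - a0) \<bullet> log_curve u = ln (1 - u) - shift2"
  unfolding log_curve_def inner_add_right inner_scaleR_right dual by simp_all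

lemma zero_set_is_curve:
  "eval_fewnomial f (expv w) = 0 \<longleftrightarrow> (\<exists>u\<in>{0<..<1}. w = log_curve u)"
proof
  assume "\<exists>u\<in>{0<..<1}. w = log_curve u"
  then show "eval_fewnomial f (expv w) = 0"
    unfolding eval_expv_eq_0_iff by (auto simp: inner_log_curve)
next
  assume "eval_fewnomial f (expv w) = 0"
  then have s: "exp ((a1 - a0) \<bullet> w + shift1) + exp ((a2 - a0) \<bullet> w + shift2) = 1"
    by (simp add: eval_expv_eq_0_iff)
  let ?u = "exp ((a1 - a0) \<bullet> w + shift1)"
  have "1 - ?u = exp ((a2 - a0) \<bullet> w + shift2)" using s by simp
  then have "ln ?u - shift1 = (a1 - a0) \<bullet> w" "ln (1 - ?u) - shift2 = (a2 - a0) \<bullet> w" by simp_all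
  then have "log_curve ?u = w" unfolding log_curve_def using span[of w] by simp
  moreover have "?u \<in> {0<..<1}"
  proof -
    have "?u < 1" using s exp_gt_zero[of "(a2 - a0) \<bullet> w + shift2"] by linarith
    then show ?thesis unfolding greaterThanLessThan_iff using exp_gt_zero by blast
  qed
  ultimately show "\<exists>u\<in>{0<..<1}. w = log_curve u" by metis
qed

lemma inj_on_log_curve: "inj_on log_curve {0<..<1}"
proof (rule inj_onI)
  fix u v :: real assume uv: "u \<in> {0<..<1}" "v \<in> {0<..<1}" and "log_curve u = log_curve v"
  then have "ln u - shift1 = ln v - shift1" by (metis inner_log_curve(1))
  then show "u = v" using uv by simp
qed

lemma eval_on_curve:
  assumes u: "u \<in> {0<..<1}"
  shows "eval_fewnomial g (expv (log_curve u)) = restr g u"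
proof -
  have "exp (a \<bullet> log_curve u) = weight a * beta_term (a \<bullet> e1) (a \<bullet> e2) u" for a
  proof -
    have "a \<bullet> log_curve u = (- (shift1 * (a \<bullet> e1)) - shift2 * (a \<bullet> e2)) + ((a \<bullet> e1) * ln u + (a \<bullet> e2) * ln (1 - u))"
      by (simp add: log_curve_def inner_add_right algebra_simps)
    then show ?thesis using u by (simp only: exp_add weight_def) (simp add: beta_term_def powr_def)
  qed
  then show ?thesis unfolding eval_fewnomial_expv restr_def by (simp add: mult.assoc)
qed

lemma pos_roots_on_curve:
  fixes F :: "2 \<Rightarrow> 2 fewnomial"
  assumes "F 1 = f"
  shows "pos_roots F = (\<lambda>u. expv (log_curve u)) ` {u\<in>{0<..<1}. restr (F 2) u = 0}"
proof (intro set_eqI iffI)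
  fix x assume x: "x \<in> pos_roots F"
  then obtain w where w: "x = expv w" using pos_orthant_expv by (auto simp: pos_roots_2)
  then obtain u where "u \<in> {0<..<1}" "w = log_curve u"
    using x assms zero_set_is_curve by (auto simp: pos_roots_2)
  then show "x \<in> (\<lambda>u. expv (log_curve u)) ` {u\<in>{0<..<1}. restr (F 2) u = 0}"
    using x w eval_on_curve by (auto simp: pos_roots_2)
next
  fix x assume "x \<in> (\<lambda>u. expv (log_curve u)) ` {u\<in>{0<..<1}. restr (F 2) u = 0}"
  then obtain u where u: "u \<in> {0<..<1}" "restr (F 2) u = 0" "x = expv (log_curve u)" by blast
  then have "eval_fewnomial (F 1) x = 0" using assms zero_set_is_curve by blast
  then show "x \<in> pos_roots F" using u eval_on_curve[OF u(1)] by (simp add: pos_roots_2)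
qed

lemma continuous_on_log_curve: "continuous_on {0<..<1} (\<lambda>u. expv (log_curve u))"
  unfolding log_curve_def by (intro continuous_on_expv continuous_intros) auto

text \<open>
If the second equation vanishes along the whole curve, a piece of curve through any root consists
of roots.
\<close>

lemma isolated_on_curve:
  fixes F :: "2 \<Rightarrow> 2 fewnomial"
  assumes F: "F 1 = f" and n: "fewer_zeros (restr (F 2)) {0<..<1} n"
  shows "{z. isolated_root F z} = {} \<or>
    finite {u\<in>{0<..<1}. restr (F 2) u = 0} \<and> card {u\<in>{0<..<1}. restr (F 2) u = 0} < n \<and>
    card {z. isolated_root F z} \<le> card {u\<in>{0<..<1}. restr (F 2) u = 0} \<and>
    finite {z. isolated_root F z}"
proof (cases "\<forall>u\<in>{0<..<1}. restr (F 2) u = 0")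
  case True
  have "\<not> isolated_root F (expv (log_curve u))" if u: "u \<in> {0<..<1}" for u
  proof (rule not_isolated_on_curve[of u "(u + 1) / 2"])
    have sub: "{u..(u + 1) / 2} \<subseteq> {0<..<1}" using u by auto
    show "continuous_on {u..(u + 1) / 2} (\<lambda>u. expv (log_curve u))"
      by (rule continuous_on_subset[OF continuous_on_log_curve sub])
    show "inj_on (\<lambda>u. expv (log_curve u)) {u..(u + 1) / 2}"
      using inj_on_subset[OF inj_on_log_curve sub] by (simp add: inj_on_def)
    show "(\<lambda>u. expv (log_curve u)) ` {u..(u + 1) / 2} \<subseteq> pos_roots F"
      unfolding pos_roots_on_curve[of F, OF F] using sub True by blast
  qed (use u in simp)
  then have "{z. isolated_root F z} = {}"
    using pos_roots_on_curve[of F, OF F] by (auto simp: isolated_root_def)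
  then show ?thesis by simp
next
  case False
  then have fin: "finite {u\<in>{0<..<1}. restr (F 2) u = 0}" "card {u\<in>{0<..<1}. restr (F 2) u = 0} < n"
    using n unfolding fewer_zeros_def by blast+
  have "{z. isolated_root F z} \<subseteq> (\<lambda>u. expv (log_curve u)) ` {u\<in>{0<..<1}. restr (F 2) u = 0}"
    using pos_roots_on_curve[of F, OF F] by (auto simp: isolated_root_def)
  then have "finite {z. isolated_root F z}"
    "card {z. isolated_root F z} \<le> card {u\<in>{0<..<1}. restr (F 2) u = 0}"
    using fin(1) by (meson finite_imageI finite_subset surj_card_le)+
  then show ?thesis using fin by blast
qed

lemma fewer_zeros_restr: "fewer_zeros (restr g) {0<..<1} (2 ^ card (Poly_Mapping.keys g) - 1)"
proof -
  have "fewer_zeros (\<lambda>u. \<Sum>a\<in>Poly_Mapping.keys g. poly [:Poly_Mapping.lookup g a * weight a:] u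
      * beta_term (a \<bullet> e1) (a \<bullet> e2) u) {0<..<1} (1 * (2 ^ card (Poly_Mapping.keys g) - 1))"
    by (rule fewer_zeros_beta_sum) (auto simp: coeff_pCons split: nat.split)
  then show ?thesis by (simp add: restr_def[abs_def])
qed

text \<open>
Division by the term at \<open>b\<^sub>0\<close> makes it constant.
\<close>

lemma fewer_zeros_restr_same_sign:
  assumes keys_g: "Poly_Mapping.keys g = {b0, b1, b2}" "b0 \<noteq> b1" "b0 \<noteq> b2" "b1 \<noteq> b2"
    and sg: "Poly_Mapping.lookup g b1 * Poly_Mapping.lookup g b2 > 0"
  shows "fewer_zeros (restr g) {0<..<1} 6"
proof -
  let ?c = "\<lambda>b. Poly_Mapping.lookup g b * weight b"
  let ?t = "\<lambda>b u. beta_term ((b - b0) \<bullet> e1) ((b - b0) \<bullet> e2) u"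
  have "fewer_zeros (\<lambda>u. ?c b0 + ?c b1 * ?t b1 u + ?c b2 * ?t b2 u) {0<..<1} 6"
  proof (rule fewer_zeros_three_beta_terms)
    have "?c b1 * ?c b2 = (Poly_Mapping.lookup g b1 * Poly_Mapping.lookup g b2) * (weight b1 * weight b2)"
      by (simp add: algebra_simps)
    then show "0 < ?c b1 * ?c b2"
      using mult_pos_pos[OF sg mult_pos_pos[OF weight_pos[of b1] weight_pos[of b2]]] by (simp only:)
  qed
  then show ?thesis
  proof (rule fewer_zeros_cong_zeros)
    fix u :: real assume u: "u \<in> {0<..<1}"
    have split: "beta_term (b \<bullet> e1) (b \<bullet> e2) u = beta_term (b0 \<bullet> e1) (b0 \<bullet> e2) u * ?t b u" for b
      by (simp add: beta_term_mult inner_diff_left)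
    have "restr g u = ?c b0 * beta_term (b0 \<bullet> e1) (b0 \<bullet> e2) u
        + ?c b1 * beta_term (b1 \<bullet> e1) (b1 \<bullet> e2) u + ?c b2 * beta_term (b2 \<bullet> e1) (b2 \<bullet> e2) u"
      unfolding restr_def using keys_g(2-) by (simp add: keys_g(1) add.assoc)
    also have "\<dots> = beta_term (b0 \<bullet> e1) (b0 \<bullet> e2) u * (?c b0 + ?c b1 * ?t b1 u + ?c b2 * ?t b2 u)"
      unfolding split[of b1] split[of b2] by (simp only: distrib_left mult_ac)
    finally show "restr g u = 0 \<longleftrightarrow> ?c b0 + ?c b1 * ?t b1 u + ?c b2 * ?t b2 u = 0" using u by simp
  qed
qed

lemma log_deriv_scaleR: "log_deriv g w (t *\<^sub>R h) = t * log_deriv g w h"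
  by (simp add: log_deriv_def sum_distrib_left algebra_simps)

text \<open>
The velocity of \<^const>\<open>log_curve\<close>.
\<close>

definition tangent :: "real \<Rightarrow> real ^ 2" where
  "tangent u = (1 / u) *\<^sub>R e1 - (1 / (1 - u)) *\<^sub>R e2"

lemma deriv_along_curve:
  assumes u: "u \<in> {0<..<1}"
  shows "((\<lambda>u. eval_fewnomial g (expv (log_curve u))) has_real_derivative
    log_deriv g (log_curve u) (tangent u)) (at u)"
proof -
  have l1: "((\<lambda>u. ln u - shift1) has_derivative (\<lambda>t. t * (1 / u))) (at u)"
    using u by (auto intro!: derivative_eq_intros simp: divide_inverse)
  have l2: "((\<lambda>u. ln (1 - u) - shift2) has_derivative (\<lambda>t. t * - (1 / (1 - u)))) (at u)"
    using u by (auto intro!: derivative_eq_intros simp: divide_inverse)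
  have "(log_curve has_derivative (\<lambda>t. (t * (1 / u)) *\<^sub>R e1 + (t * - (1 / (1 - u))) *\<^sub>R e2)) (at u)"
    unfolding log_curve_def[abs_def]
    by (intro has_derivative_add has_derivative_scaleR_left l1 l2)
  moreover have "(\<lambda>t. (t * (1 / u)) *\<^sub>R e1 + (t * - (1 / (1 - u))) *\<^sub>R e2) = (\<lambda>t. t *\<^sub>R tangent u)"
    by (simp add: tangent_def scaleR_diff_right)
  ultimately have "(log_curve has_derivative (\<lambda>t. t *\<^sub>R tangent u)) (at u)" by simp
  from has_derivative_compose[OF this has_derivative_eval_expv]
  have "((\<lambda>u. eval_fewnomial g (expv (log_curve u))) has_derivative
      (\<lambda>t. t * log_deriv g (log_curve u) (tangent u))) (at u)"
    by (simp add: log_deriv_scaleR)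
  then show ?thesis unfolding has_field_derivative_def by (rule has_derivative_eq_rhs) auto
qed

text \<open>
In the direction \<open>e\<^sub>1 + e\<^sub>2\<close> the terms at \<open>a\<^sub>1\<close> and \<open>a\<^sub>2\<close> grow at the same rate relative to the term at \<open>a\<^sub>0\<close>, so
the balance between them is destroyed to first order.
\<close>

lemma log_deriv_transversal:
  assumes "eval_fewnomial f (expv w) = 0"
  shows "log_deriv f w (e1 + e2) \<noteq> 0"
proof -
  let ?T = "\<lambda>a. Poly_Mapping.lookup f a * exp (a \<bullet> w)"
  let ?h = "e1 + e2"
  have z: "?T a0 + ?T a1 + ?T a2 = 0" using assms by (simp add: eval_fewnomial_expv sum_keys)
  have h: "a1 \<bullet> ?h = a0 \<bullet> ?h + 1" "a2 \<bullet> ?h = a0 \<bullet> ?h + 1"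
    using dual by (simp_all add: inner_diff_left inner_add_right)
  have "log_deriv f w ?h = ?T a0 * (a0 \<bullet> ?h) + ?T a1 * (a1 \<bullet> ?h) + ?T a2 * (a2 \<bullet> ?h)"
    unfolding log_deriv_def sum_keys by (simp add: mult.assoc)
  also have "\<dots> = (a0 \<bullet> ?h) * (?T a0 + ?T a1 + ?T a2) + (?T a0 + ?T a1 + ?T a2) - ?T a0"
    unfolding h by (simp add: algebra_simps)
  finally show ?thesis unfolding z using coeffs(3) by simp
qed

lemma nondegenerate_on_curve:
  fixes G :: "2 \<Rightarrow> 2 fewnomial"
  assumes G: "G 1 = f" and u: "u \<in> {0<..<1}" "restr (G 2) u = 0"
    and D: "(restr (G 2) has_real_derivative D) (at u)" "D \<noteq> 0"
  shows "nondegenerate_root G (expv (log_curve u))"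
proof (rule nondegenerate_root_expv[where ?h1.0 = "tangent u" and ?h2.0 = "e1 + e2"])
  have near: "eventually (\<lambda>u. u \<in> {0<..<1}) (nhds u)"
    using u(1) by (intro eventually_nhds_in_open) auto
  have f0: "eval_fewnomial f (expv (log_curve v)) = 0" if "v \<in> {0<..<1}" for v
    using that zero_set_is_curve by blast
  show "expv (log_curve u) \<in> pos_roots G"
    using pos_roots_on_curve[of G, OF G] u by blast
  have "((\<lambda>u. eval_fewnomial f (expv (log_curve u))) has_real_derivative 0) (at u)"
    by (rule DERIV_cong_ev[OF refl _ refl, THEN iffD2, of _ "\<lambda>_. 0"])
      (use eventually_mono[OF near f0] in auto)
  then show "log_deriv (G 1) (log_curve u) (tangent u) = 0"
    unfolding G using DERIV_unique deriv_along_curve[OF u(1)] by blast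
  have "((\<lambda>u. eval_fewnomial (G 2) (expv (log_curve u))) has_real_derivative D) (at u)"
    by (rule DERIV_cong_ev[OF refl _ refl, THEN iffD2, OF _ D(1)])
      (rule eventually_mono[OF near eval_on_curve])
  then have "log_deriv (G 2) (log_curve u) (tangent u) = D"
    using DERIV_unique deriv_along_curve[OF u(1)] by blast
  then show "log_deriv (G 2) (log_curve u) (tangent u) \<noteq> 0" using D(2) by simp
  show "log_deriv (G 1) (log_curve u) (e1 + e2) \<noteq> 0"
    unfolding G using f0[OF u(1)] by (rule log_deriv_transversal)
qed

text \<open>
Write \<open>restr g = T R\<close>, where \<open>T\<close> gives the values on the curve of a monomial \<open>a\<close> of \<open>g\<close>.  Subtracting \<open>\<epsilon>\<close> from the coefficient of
\<open>a\<close> turns \<open>T R\<close> into \<open>T (R - \<epsilon>)\<close>.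
\<close>

lemma perturb_to_nondegenerate:
  assumes fin: "finite {u\<in>{0<..<1}. restr g u = 0}" and ne: "Poly_Mapping.keys g \<noteq> {}"
  shows "\<exists>g' Y. card (Poly_Mapping.keys g') = card (Poly_Mapping.keys g) \<and> finite Y \<and>
    card Y = card {u\<in>{0<..<1}. restr g u = 0} \<and>
    Y \<subseteq> {z. nondegenerate_root (\<lambda>i::2. if i = 1 then f else g') z}"
proof -
  obtain a where a: "a \<in> Poly_Mapping.keys g" using ne by blast
  let ?K = "Poly_Mapping.keys g"
  let ?T = "\<lambda>u. weight a * beta_term (a \<bullet> e1) (a \<bullet> e2) u"
  define C where "C b = Poly_Mapping.lookup g b * weight b / weight a" for b
  define R where "R u = (\<Sum>b\<in>?K. poly [:C b:] u * beta_term ((b - a) \<bullet> e1) ((b - a) \<bullet> e2) u)" for u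
  define R' where "R' u = (\<Sum>b\<in>?K. poly (beta_deriv_poly ((b - a) \<bullet> e1) ((b - a) \<bullet> e2) [:C b:]) u
      * beta_term ((b - a) \<bullet> e1 - 1) ((b - a) \<bullet> e2 - 1) u)" for u
  have wa: "weight a \<noteq> 0" using weight_pos[of a] by simp
  have DR: "(R has_real_derivative R' u) (at u)" if "u \<in> {0<..<1}" for u
    unfolding R_def[abs_def] R'_def by (intro DERIV_sum has_derivative_poly_beta_term that)
  have restr_R: "restr g u = ?T u * R u" for u
    unfolding restr_def R_def sum_distrib_left
  proof (intro sum.cong refl)
    fix b
    have "beta_term (a \<bullet> e1) (a \<bullet> e2) u * beta_term ((b - a) \<bullet> e1) ((b - a) \<bullet> e2) u
        = beta_term (b \<bullet> e1) (b \<bullet> e2) u"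
      by (simp add: beta_term_mult inner_diff_left)
    then show "Poly_Mapping.lookup g b * weight b * beta_term (b \<bullet> e1) (b \<bullet> e2) u
      = ?T u * (poly [:C b:] u * beta_term ((b - a) \<bullet> e1) ((b - a) \<bullet> e2) u)"
      using wa by (simp add: C_def)
  qed
  have zeros: "{u\<in>{0<..<1}. restr g u = 0} = {u\<in>{0<..<1}. R u = 0}"
    using wa by (auto simp: restr_R)
  have "fewer_zeros R' {0<..<1} (Suc 1 * (2 ^ card ?K - 1))"
    unfolding R'_def[abs_def]
    by (rule fewer_zeros_beta_sum, simp, rule coeff_beta_deriv_poly)
      (auto simp: coeff_pCons split: nat.split)
  then consider "\<forall>u\<in>{0<..<1}. R' u = 0" | "finite {u\<in>{0<..<1}. R' u = 0}"
    unfolding fewer_zeros_def by blast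
  then show ?thesis
  proof cases
    case 1
    then have "fewer_zeros R' {0<..<1} 0" by (simp add: fewer_zeros_def)
    then have "fewer_zeros R {0<..<1} 1"
      using fewer_zeros_Rolle[of "{0<..<1}" R R' 0] DR by simp
    moreover have "\<not> (\<forall>u\<in>{0<..<1}. R u = 0)"
    proof
      assume "\<forall>u\<in>{0<..<1}. R u = 0"
      then have "{u\<in>{0<..<1}. R u = 0} = {0<..<1}" by blast
      then show False using fin unfolding zeros by (simp add: infinite_Ioo)
    qed
    ultimately have "card {u\<in>{0<..<1}. R u = 0} = 0" unfolding fewer_zeros_def by auto
    then show ?thesis unfolding zeros by (intro exI[of _ g] exI[of _ "{}"]) simp
  next
    case 2
    have cont: "continuous_on {0<..<1} R"
      using DR by (meson DERIV_continuous_on has_field_derivative_at_within)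
    have la: "Poly_Mapping.lookup g a \<noteq> 0" using a by (simp add: in_keys_iff)
    obtain \<epsilon> X where \<epsilon>: "\<epsilon> \<noteq> Poly_Mapping.lookup g a" and X: "finite X"
      "card X = card {u\<in>{0<..<1}. R u = 0}"
      "\<And>u. u \<in> X \<Longrightarrow> u \<in> {0<..<1} \<and> R u = \<epsilon> \<and> R' u \<noteq> 0"
      by (rule regular_level_with_many_solutions[OF cont fin[unfolded zeros] 2 la]) blast
    define g' where "g' = g - Poly_Mapping.single a \<epsilon>"
    let ?G = "\<lambda>i::2. if i = 1 then f else g'"
    have lookup: "Poly_Mapping.lookup g' b = Poly_Mapping.lookup g b - (if b = a then \<epsilon> else 0)" for b
      by (simp add: g'_def lookup_minus lookup_single when_def)
    have keys': "Poly_Mapping.keys g' = ?K"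
      using \<epsilon> la by (auto simp: in_keys_iff lookup split: if_splits)
    have restr': "restr g' u = ?T u * (R u - \<epsilon>)" for u
    proof -
      have "restr g' u = (\<Sum>b\<in>?K. Poly_Mapping.lookup g b * weight b * beta_term (b \<bullet> e1) (b \<bullet> e2) u
          - (if b = a then \<epsilon> * ?T u else 0))"
        unfolding restr_def keys' lookup by (intro sum.cong) (auto simp: algebra_simps)
      also have "\<dots> = restr g u - \<epsilon> * ?T u"
        using a unfolding sum_subtractf restr_def by simp
      finally show ?thesis unfolding restr_R by (simp add: algebra_simps)
    qed
    have nondeg: "nondegenerate_root ?G (expv (log_curve u))" if "u \<in> X" for u
    proof (rule nondegenerate_on_curve)
      have u: "u \<in> {0<..<1}" "R u = \<epsilon>" "R' u \<noteq> 0" using X(3)[OF that] by auto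
      show "u \<in> {0<..<1}" "?G 1 = f" by (use u in auto)
      show "restr (?G 2) u = 0" using u by (simp add: restr')
      have "(?T has_real_derivative weight a * ((a \<bullet> e1 - (a \<bullet> e1 + a \<bullet> e2) * u)
          * beta_term (a \<bullet> e1 - 1) (a \<bullet> e2 - 1) u)) (at u)"
        by (intro DERIV_cmult has_derivative_beta_term u)
      from DERIV_mult[OF this DERIV_diff[OF DR[OF u(1)] DERIV_const[of \<epsilon>]]]
      have "((\<lambda>u. ?T u * (R u - \<epsilon>)) has_real_derivative R' u * ?T u) (at u)"
        using u(2) by simp
      then show "(restr (?G 2) has_real_derivative R' u * ?T u) (at u)"
        by (simp add: restr'[abs_def])
      show "R' u * ?T u \<noteq> 0" using u wa by auto
    qed
    have "X \<subseteq> {0<..<1}" using X(3) by blast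
    then have "inj_on (\<lambda>u. expv (log_curve u)) X"
      using inj_on_subset[OF inj_on_log_curve] by (simp add: inj_on_def)
    then have "card ((\<lambda>u. expv (log_curve u)) ` X) = card {u\<in>{0<..<1}. restr g u = 0}"
      unfolding zeros by (simp add: card_image X(2))
    then show ?thesis using keys' nondeg X(1)
      by (intro exI[of _ g'] exI[of _ "(\<lambda>u. expv (log_curve u)) ` X"]) auto
  qed
qed

end

section \<open>Upper bounds for the number of isolated roots\<close>

definition det2 :: "real ^ 2 \<Rightarrow> real ^ 2 \<Rightarrow> real" where
  "det2 p q = p $ 1 * q $ 2 - p $ 2 * q $ 1"

text \<open>
Cramer's rule provides the dual basis.
\<close>

lemma normal_trinomialI:
  assumes keys: "Poly_Mapping.keys f = {a0, a1, a2}"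
    and signs: "Poly_Mapping.lookup f a0 * Poly_Mapping.lookup f a1 < 0"
      "Poly_Mapping.lookup f a0 * Poly_Mapping.lookup f a2 < 0"
    and det: "det2 (a1 - a0) (a2 - a0) \<noteq> 0"
  shows "\<exists>e1 e2. normal_trinomial f a0 a1 a2 e1 e2"
proof -
  define p q D where "p = a1 - a0" and "q = a2 - a0" and "D = det2 p q"
  define e1 e2 :: "real ^ 2" where "e1 = (1 / D) *\<^sub>R vector [q $ 2, - (q $ 1)]"
    and "e2 = (1 / D) *\<^sub>R vector [- (p $ 2), p $ 1]"
  have D: "D \<noteq> 0" using det by (simp add: D_def p_def q_def)
  have "D *\<^sub>R w = (p \<bullet> w) *\<^sub>R vector [q $ 2, - (q $ 1)] + (q \<bullet> w) *\<^sub>R vector [- (p $ 2), p $ 1]" for w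
    by (simp add: D_def det2_def vec_eq_iff forall_2 inner_vec_def sum_2 algebra_simps)
  then have "(1 / D) *\<^sub>R (D *\<^sub>R w) = (1 / D) *\<^sub>R ((p \<bullet> w) *\<^sub>R vector [q $ 2, - (q $ 1)]
      + (q \<bullet> w) *\<^sub>R vector [- (p $ 2), p $ 1])" for w by simp
  then have span: "w = (p \<bullet> w) *\<^sub>R e1 + (q \<bullet> w) *\<^sub>R e2" for w
    using D by (simp add: e1_def e2_def scaleR_add_right)
  have "p \<bullet> vector [q $ 2, - (q $ 1)] = D" "p \<bullet> vector [- (p $ 2), p $ 1] = 0"
    "q \<bullet> vector [q $ 2, - (q $ 1)] = 0" "q \<bullet> vector [- (p $ 2), p $ 1] = D"
    by (simp_all add: inner_vec_def sum_2 D_def det2_def algebra_simps)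
  then have "p \<bullet> e1 = 1" "p \<bullet> e2 = 0" "q \<bullet> e1 = 0" "q \<bullet> e2 = 1"
    using D by (simp_all add: e1_def e2_def)
  then have "normal_trinomial f a0 a1 a2 e1 e2"
    using keys signs span unfolding p_def q_def by unfold_locales auto
  then show ?thesis by blast
qed

text \<open>
Three nonzero coefficients either have the same sign, or exactly one of them has a sign different
from the two others; that one takes the role of \<open>a\<^sub>0\<close>.
\<close>

lemma trinomial_cases:
  fixes f :: "2 fewnomial"
  assumes "card (Poly_Mapping.keys f) = 3"
  obtains (collinear) a v t where "Poly_Mapping.keys f = {a, a + v, a + t *\<^sub>R v}" "v \<noteq> 0" "t \<noteq> 0" "t \<noteq> 1"
  | (normal) a0 a1 a2 e1 e2 where "normal_trinomial f a0 a1 a2 e1 e2"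
  | (no_root) "\<And>x. x \<in> pos_orthant \<Longrightarrow> eval_fewnomial f x \<noteq> 0"
proof -
  obtain b0 b1 b2 where keys: "Poly_Mapping.keys f = {b0, b1, b2}"
    and ne: "b0 \<noteq> b1" "b0 \<noteq> b2" "b1 \<noteq> b2"
    using assms by (auto simp: card_3_iff)
  let ?l = "Poly_Mapping.lookup f"
  have nz: "?l b0 \<noteq> 0" "?l b1 \<noteq> 0" "?l b2 \<noteq> 0"
    using keys by (simp_all flip: in_keys_iff)
  show thesis
  proof (cases "det2 (b1 - b0) (b2 - b0) = 0")
    case True
    define v where "v = b1 - b0"
    define q where "q = b2 - b0"
    have v: "v \<noteq> 0" using ne by (simp add: v_def)
    have d: "v $ 1 * q $ 2 = v $ 2 * q $ 1" using True by (simp add: det2_def v_def q_def)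
    have "\<exists>t. q = t *\<^sub>R v"
    proof (cases "v $ 1 = 0")
      case True
      then have "v $ 2 \<noteq> 0" using v by (simp add: vec_eq_iff forall_2)
      then show ?thesis using True d by (intro exI[of _ "q $ 2 / v $ 2"]) (simp add: vec_eq_iff forall_2)
    next
      case False
      then show ?thesis using d by (intro exI[of _ "q $ 1 / v $ 1"]) (simp add: vec_eq_iff forall_2 field_simps)
    qed
    then obtain t where t: "q = t *\<^sub>R v" by blast
    then have b: "b1 = b0 + v" "b2 = b0 + t *\<^sub>R v" by (auto simp: v_def q_def algebra_simps)
    then have "t \<noteq> 0" "t \<noteq> 1" using ne by auto
    then show thesis using collinear[of b0 v t] keys b v by simp
  next
    case det: False
    then have det': "det2 (b0 - b1) (b2 - b1) \<noteq> 0" "det2 (b0 - b2) (b1 - b2) \<noteq> 0"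
      by (auto simp: det2_def algebra_simps)
    consider "?l b0 * ?l b1 < 0" "?l b0 * ?l b2 < 0" | "?l b1 * ?l b0 < 0" "?l b1 * ?l b2 < 0"
      | "?l b2 * ?l b0 < 0" "?l b2 * ?l b1 < 0"
      | "?l b0 > 0" "?l b1 > 0" "?l b2 > 0" | "?l b0 < 0" "?l b1 < 0" "?l b2 < 0"
      using nz by (auto simp: mult_less_0_iff) argo
    then show thesis
    proof cases
      case 1
      then show thesis using normal_trinomialI[of f b0 b1 b2] keys det normal by blast
    next
      case 2
      then show thesis using normal_trinomialI[of f b1 b0 b2] keys det' normal by blast
    next
      case 3
      then show thesis using normal_trinomialI[of f b2 b0 b1] keys det' normal by blast
    next
      case 4
      have "eval_fewnomial f (expv w) > 0" for w
        unfolding eval_fewnomial_expv using 4 keys by (intro sum_pos) auto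
      then show thesis using no_root pos_orthant_expv by (metis less_irrefl)
    next
      case 5
      have "eval_fewnomial f (expv w) < 0" for w
        unfolding eval_fewnomial_expv keys using 5 ne by (simp add: mult_neg_pos add_neg_neg)
      then show thesis using no_root pos_orthant_expv by (metis less_irrefl)
    qed
  qed
qed

lemma linear_le_exponential: "3 \<le> m \<Longrightarrow> 2 * (m - 1) \<le> 2 ^ m - (2::nat)"
proof (induction m rule: dec_induct)
  case (step n)
  then show ?case by simp
qed simp

text \<open>
Among three nonzero coefficients two have the same sign, so for \<open>m = 3\<close> the sharper count applies.
\<close>

lemma normal_trinomial_fewer_zeros:
  assumes "normal_trinomial f a0 a1 a2 e1 e2" and m: "card (Poly_Mapping.keys g) = m"
  shows "fewer_zeros (normal_trinomial.restr f a0 a1 a2 e1 e2 g) {0<..<1} (if m = 3 then 6 else 2 ^ m - 1)"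
proof (cases "m = 3")
  case False
  then show ?thesis using normal_trinomial.fewer_zeros_restr[OF assms(1), of g] m by simp
next
  case True
  then obtain b0 b1 b2 where b: "Poly_Mapping.keys g = {b0, b1, b2}"
    "b0 \<noteq> b1" "b0 \<noteq> b2" "b1 \<noteq> b2"
    using m by (auto simp: card_3_iff)
  let ?l = "Poly_Mapping.lookup g"
  have nz: "?l b0 \<noteq> 0" "?l b1 \<noteq> 0" "?l b2 \<noteq> 0"
    using b(1) by (simp_all flip: in_keys_iff)
  note same = normal_trinomial.fewer_zeros_restr_same_sign[OF assms(1), of g]
  consider "?l b0 * ?l b1 > 0" | "?l b0 * ?l b2 > 0" | "?l b1 * ?l b2 > 0"
    using nz by (auto simp: zero_less_mult_iff) argo
  then have "fewer_zeros (normal_trinomial.restr f a0 a1 a2 e1 e2 g) {0<..<1} 6"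
  proof cases
    case 1
    then show ?thesis using same[of b2 b0 b1] b by (simp add: insert_commute)
  next
    case 2
    then show ?thesis using same[of b1 b0 b2] b by (simp add: insert_commute)
  next
    case 3
    then show ?thesis using same[of b0 b1 b2] b by simp
  qed
  then show ?thesis using True by simp
qed

lemma isolated_bound:
  fixes F :: "2 \<Rightarrow> 2 fewnomial"
  assumes f: "card (Poly_Mapping.keys (F 1)) = 3" and g: "card (Poly_Mapping.keys (F 2)) = m" and m: "3 \<le> m"
  shows "finite {z. isolated_root F z} \<and>
    card {z. isolated_root F z} \<le> (if m = 3 then 5 else 2 ^ m - 2)"
proof -
  from f show ?thesis
  proof (cases rule: trinomial_cases)
    case (collinear a v t)
    have "card (Poly_Mapping.keys (F 2)) \<ge> 1" using g m by simp
    from isolated_collinear[OF collinear this]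
    have "finite {z. isolated_root F z}" "card {z. isolated_root F z} \<le> 2 * (m - 1)" using g by auto
    then show ?thesis using linear_le_exponential[OF m] by auto
  next
    case (normal a0 a1 a2 e1 e2)
    from normal_trinomial.isolated_on_curve[OF this refl normal_trinomial_fewer_zeros[OF this g]]
    show ?thesis
    proof
      assume "{z. isolated_root F z} = {}"
      then show ?thesis by (simp only: finite.emptyI card.empty) simp
    qed (auto split: if_splits)
  next
    case no_root
    then have "{z. isolated_root F z} = {}" by (auto simp: isolated_root_def pos_roots_2)
    then show ?thesis by simp
  qed
qed

section \<open>Systems with many nondegenerate roots\<close>

definition root_poly :: "nat \<Rightarrow> real poly" where
  "root_poly n = (\<Prod>j\<in>{1..n}. [:- real j, 1:])"

lemma poly_root_poly: "poly (root_poly n) x = (\<Prod>j\<in>{1..n}. x - real j)"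
  by (simp add: root_poly_def poly_prod)

lemma degree_root_poly: "degree (root_poly n) = n"
  by (simp add: root_poly_def degree_prod_sum_eq)

lemma pderiv_root_poly_nonzero:
  assumes "j \<in> {1..n}"
  shows "poly (pderiv (root_poly n)) (real j) \<noteq> 0"
proof -
  define q where "q = (\<Prod>i\<in>{1..n} - {j}. [:- real i, 1:])"
  have "root_poly n = [:- real j, 1:] * q"
    unfolding root_poly_def q_def using assms by (intro prod.remove) auto
  then have "poly (pderiv (root_poly n)) (real j) = poly q (real j)"
    by (simp add: pderiv_mult pderiv_pCons del: mult_pCons_left)
  then show ?thesis by (simp add: q_def poly_prod)
qed

text \<open>
The polynomial has \<open>n\<close> positive roots, so by the Descartes bound it has more than \<open>n\<close> terms; its
degree \<open>n\<close> leaves no room for a vanishing coefficient.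
\<close>

lemma coeff_root_poly_nonzero:
  assumes "i \<le> n"
  shows "coeff (root_poly n) i \<noteq> 0"
proof -
  define K where "K = {i. coeff (root_poly n) i \<noteq> 0}"
  have K: "K \<subseteq> {..n}" using degree_root_poly[of n] le_degree by (fastforce simp: K_def)
  then have finK: "finite K" using finite_subset by blast
  let ?g = "\<lambda>t. \<Sum>i\<in>K. coeff (root_poly n) i * exp (real i * t)"
  have g: "?g t = poly (root_poly n) (exp t)" for t
  proof -
    have "poly (root_poly n) (exp t) = (\<Sum>i\<le>n. coeff (root_poly n) i * exp (real i * t))"
      unfolding poly_altdef degree_root_poly by (simp add: exp_of_nat_mult)
    also have "\<dots> = ?g t" using K by (intro sum.mono_neutral_right) (auto simp: K_def)
    finally show ?thesis by simp
  qed
  \<comment> \<open>\<open>n + 1\<close> is a point that is not a root, so the sum does not vanish identically\<close>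
  have "?g (ln (real (Suc n))) \<noteq> 0" unfolding g poly_root_poly by auto
  then have fin: "finite {t. ?g t = 0}" "card {t. ?g t = 0} < card K"
    using fewer_zeros_exp_sum[OF finK, of "coeff (root_poly n)" real]
    unfolding fewer_zeros_def by auto
  have "(\<lambda>j. ln (real j)) ` {1..n} \<subseteq> {t. ?g t = 0}"
    unfolding g poly_root_poly by auto
  from card_mono[OF fin(1) this] have "card ((\<lambda>j. ln (real j)) ` {1..n}) \<le> card {t. ?g t = 0}" .
  moreover have "card ((\<lambda>j. ln (real j)) ` {1..n}) = n"
    by (subst card_image) (auto simp: inj_on_def)
  ultimately have "n \<le> card {t. ?g t = 0}" by simp
  then have "card {..n} \<le> card K" using fin(2) by simp
  then have "K = {..n}" using card_seteq[OF _ K] by simp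
  then show ?thesis using assms by (auto simp: K_def)
qed

text \<open>
The polynomial \<open>p\<close> evaluated at the monomial with exponent vector \<open>d\<close>.
\<close>

definition poly_fewnomial :: "real ^ 2 \<Rightarrow> real poly \<Rightarrow> 2 fewnomial" where
  "poly_fewnomial d p = (\<Sum>i\<le>degree p. Poly_Mapping.single (real i *\<^sub>R d) (coeff p i))"

lemma poly_fewnomial:
  assumes d: "d \<noteq> 0" and p: "\<And>i. i \<le> degree p \<Longrightarrow> coeff p i \<noteq> 0"
  shows "card (Poly_Mapping.keys (poly_fewnomial d p)) = Suc (degree p)"
    and "eval_fewnomial (poly_fewnomial d p) (expv w) = poly p (exp (d \<bullet> w))"
proof -
  have inj: "inj_on (\<lambda>i. real i *\<^sub>R d) {..degree p}" using d by (auto simp: inj_on_def)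
  have lookup: "Poly_Mapping.lookup (poly_fewnomial d p) x
      = (\<Sum>i\<le>degree p. if real i *\<^sub>R d = x then coeff p i else 0)" for x
    unfolding poly_fewnomial_def by (simp add: lookup_sum lookup_single when_def)
  have at: "Poly_Mapping.lookup (poly_fewnomial d p) (real i *\<^sub>R d) = coeff p i" if "i \<le> degree p" for i
    unfolding lookup using d that by simp
  have keys: "Poly_Mapping.keys (poly_fewnomial d p) = (\<lambda>i. real i *\<^sub>R d) ` {..degree p}"
  proof (intro set_eqI iffI)
    fix x assume "x \<in> Poly_Mapping.keys (poly_fewnomial d p)"
    then have "Poly_Mapping.lookup (poly_fewnomial d p) x \<noteq> 0" by (simp add: in_keys_iff)
    then show "x \<in> (\<lambda>i. real i *\<^sub>R d) ` {..degree p}"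
      unfolding lookup by (rule contrapos_np) (intro sum.neutral, auto)
  qed (use p at in \<open>auto simp: in_keys_iff\<close>)
  show "card (Poly_Mapping.keys (poly_fewnomial d p)) = Suc (degree p)"
    unfolding keys card_image[OF inj] by simp
  have "eval_fewnomial (poly_fewnomial d p) (expv w) = (\<Sum>i\<le>degree p. coeff p i * exp (real i * (d \<bullet> w)))"
    unfolding eval_fewnomial_expv keys by (subst sum.reindex[OF inj]) (simp add: at)
  then show "eval_fewnomial (poly_fewnomial d p) (expv w) = poly p (exp (d \<bullet> w))"
    by (simp add: poly_altdef exp_of_nat_mult)
qed

lemma log_deriv_poly_fewnomial:
  assumes d: "d \<noteq> 0" and p: "\<And>i. i \<le> degree p \<Longrightarrow> coeff p i \<noteq> 0"
  shows "log_deriv (poly_fewnomial d p) w h = poly (pderiv p) (exp (d \<bullet> w)) * exp (d \<bullet> w) * (d \<bullet> h)"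
proof -
  have "((\<lambda>w. exp (d \<bullet> w)) has_derivative (\<lambda>h. exp (d \<bullet> w) * (d \<bullet> h))) (at w)"
    by (auto intro!: derivative_eq_intros)
  from has_derivative_compose[OF this poly_DERIV[of p, unfolded has_field_derivative_def]]
  have "((\<lambda>w. eval_fewnomial (poly_fewnomial d p) (expv w)) has_derivative
      (\<lambda>h. poly (pderiv p) (exp (d \<bullet> w)) * (exp (d \<bullet> w) * (d \<bullet> h)))) (at w)"
    by (simp only: poly_fewnomial(2)[OF d, of p, OF p])
  from has_derivative_unique[OF has_derivative_eval_expv this]
  show ?thesis by (simp add: fun_eq_iff mult.assoc)
qed

text \<open>
The points \<open>(i, j)\<close> with \<open>1 \<le> i \<le> n\<^sub>1\<close> and \<open>1 \<le> j \<le> n\<^sub>2\<close> are roots, and the Jacobian is diagonal.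
\<close>

lemma product_system_roots:
  fixes n1 n2 :: nat
  defines "G \<equiv> \<lambda>i::2. if i = 1 then poly_fewnomial (axis 1 1) (root_poly n1)
    else poly_fewnomial (axis 2 1) (root_poly n2)"
  shows "\<exists>Y. finite Y \<and> card Y = n1 * n2 \<and> Y \<subseteq> {z. nondegenerate_root G z}"
proof -
  let ?w = "\<lambda>(i, j). vector [ln (real i), ln (real j)] :: real ^ 2"
  have ax: "axis k 1 \<noteq> (0 :: real ^ 2)" "axis k 1 \<bullet> v = v $ k"
    "axis k 1 $ k' = (if k' = k then 1 else (0 :: real))" for k k' :: 2 and v :: "real ^ 2"
    by (auto simp: axis_eq_0_iff inner_axis') (auto simp: axis_def)
  have c: "coeff (root_poly n) i \<noteq> 0" if "i \<le> degree (root_poly n)" for i n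
    using coeff_root_poly_nonzero that by (simp add: degree_root_poly)
  have ne: "(2::2) \<noteq> 1" by simp
  have nondeg: "nondegenerate_root G (expv (?w (i, j)))" if ij: "i \<in> {1..n1}" "j \<in> {1..n2}" for i j
  proof (rule nondegenerate_root_expv[where ?h1.0 = "axis 2 1" and ?h2.0 = "axis 1 1"])
    have e: "exp (ln (real i)) = real i" "exp (ln (real j)) = real j" using ij by auto
    have p: "poly (root_poly n1) (real i) = 0" "poly (root_poly n2) (real j) = 0"
      using ij by (auto simp: poly_root_poly)
    show "expv (?w (i, j)) \<in> pos_roots G"
      using p by (simp add: pos_roots_2 G_def poly_fewnomial(2)[OF ax(1) c] ax(2) e ne)
    show "log_deriv (G 1) (?w (i, j)) (axis 2 1) = 0"
      by (simp add: G_def log_deriv_poly_fewnomial[OF ax(1) c] ax(2,3))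
    show "log_deriv (G 2) (?w (i, j)) (axis 2 1) \<noteq> 0"
      using pderiv_root_poly_nonzero[OF ij(2)] ij
      by (simp add: G_def log_deriv_poly_fewnomial[OF ax(1) c] ax(2,3) e ne)
    show "log_deriv (G 1) (?w (i, j)) (axis 1 1) \<noteq> 0"
      using pderiv_root_poly_nonzero[OF ij(1)] ij
      by (simp add: G_def log_deriv_poly_fewnomial[OF ax(1) c] ax(2,3) e)
  qed
  let ?Y = "(\<lambda>ij. expv (?w ij)) ` ({1..n1} \<times> {1..n2})"
  have "vector [a, b] = (vector [c, d] :: real ^ 2) \<longleftrightarrow> a = c \<and> b = d" for a b c d
    by (simp add: vec_eq_iff forall_2)
  then have "inj_on (\<lambda>ij. expv (?w ij)) ({1..n1} \<times> {1..n2})"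
    by (auto simp: inj_on_def)
  then have "card ?Y = n1 * n2" by (simp add: card_image card_cartesian_product)
  moreover have "?Y \<subseteq> {z. nondegenerate_root G z}" using nondeg by auto
  ultimately show ?thesis by (intro exI[of _ ?Y]) auto
qed

lemma nondegenerate_at_least_isolated:
  fixes F :: "2 \<Rightarrow> 2 fewnomial"
  assumes f: "card (Poly_Mapping.keys (F 1)) = 3" and g: "card (Poly_Mapping.keys (F 2)) = m" and m: "3 \<le> m"
  shows "\<exists>(G :: 2 \<Rightarrow> 2 fewnomial) Y. card (Poly_Mapping.keys (G 1)) = 3 \<and> card (Poly_Mapping.keys (G 2)) = m \<and>
    finite Y \<and> card {z. isolated_root F z} \<le> card Y \<and> Y \<subseteq> {z. nondegenerate_root G z}"
proof (cases "{z. isolated_root F z} = {}")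
  case True
  show ?thesis by (rule exI[of _ F], rule exI[of _ "{}"]) (simp add: f g True)
next
  case False
  from f show ?thesis
  proof (cases rule: trinomial_cases)
    case (collinear a v t)
    have "card (Poly_Mapping.keys (F 2)) \<ge> 1" using g m by simp
    from isolated_collinear[OF collinear this]
    have iso: "card {z. isolated_root F z} \<le> 2 * (m - 1)" using g by auto
    define G where "G = (\<lambda>i::2. if i = 1 then poly_fewnomial (axis 1 1) (root_poly 2)
      else poly_fewnomial (axis 2 1) (root_poly (m - 1)))"
    obtain Y where Y: "finite Y" "card Y = 2 * (m - 1)" "Y \<subseteq> {z. nondegenerate_root G z}"
      using product_system_roots[of 2 "m - 1"] unfolding G_def by blast
    have "card (Poly_Mapping.keys (poly_fewnomial (axis k 1) (root_poly n))) = Suc n" for k n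
      using poly_fewnomial(1)[of "axis k 1" "root_poly n"] coeff_root_poly_nonzero
      by (simp add: degree_root_poly axis_eq_0_iff)
    then show ?thesis using iso Y m
      by (intro exI[of _ G] exI[of _ Y]) (simp add: G_def)
  next
    case (normal a0 a1 a2 e1 e2)
    from normal_trinomial.isolated_on_curve[OF this refl normal_trinomial_fewer_zeros[OF this g]] False
    have fin: "finite {u\<in>{0<..<1}. normal_trinomial.restr (F 1) a0 a1 a2 e1 e2 (F 2) u = 0}"
      and le: "card {z. isolated_root F z}
        \<le> card {u\<in>{0<..<1}. normal_trinomial.restr (F 1) a0 a1 a2 e1 e2 (F 2) u = 0}" by blast+
    have ne: "Poly_Mapping.keys (F 2) \<noteq> {}" using g m by auto
    obtain g' Y where "card (Poly_Mapping.keys g') = card (Poly_Mapping.keys (F 2))" "finite Y"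
      "card Y = card {u\<in>{0<..<1}. normal_trinomial.restr (F 1) a0 a1 a2 e1 e2 (F 2) u = 0}"
      "Y \<subseteq> {z. nondegenerate_root (\<lambda>i::2. if i = 1 then F 1 else g') z}"
      using normal_trinomial.perturb_to_nondegenerate[OF normal fin ne] by blast
    then show ?thesis using le f g
      by (intro exI[of _ "\<lambda>i::2. if i = 1 then F 1 else g'"] exI[of _ Y]) simp
  next
    case no_root
    then have "{z. isolated_root F z} = {}" by (auto simp: isolated_root_def pos_roots_2)
    then show ?thesis using False by simp
  qed
qed

section \<open>A system with five isolated roots\<close>

lemma three_term_fewnomial:
  fixes a b c :: "real ^ 2"
  assumes "a \<noteq> b" "a \<noteq> c" "b \<noteq> c" "x \<noteq> 0" "y \<noteq> 0" "z \<noteq> 0"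
  defines "f \<equiv> Poly_Mapping.single a x + Poly_Mapping.single b y + Poly_Mapping.single c z"
  shows "Poly_Mapping.keys f = {a, b, c}"
    "Poly_Mapping.lookup f a = x" "Poly_Mapping.lookup f b = y" "Poly_Mapping.lookup f c = z"
    "eval_fewnomial f v = x * mono_val a v + y * mono_val b v + z * mono_val c v"
proof -
  show l: "Poly_Mapping.lookup f a = x" "Poly_Mapping.lookup f b = y" "Poly_Mapping.lookup f c = z"
    using assms by (simp_all add: lookup_add lookup_single when_def)
  show k: "Poly_Mapping.keys f = {a, b, c}"
    using assms by (auto simp: in_keys_iff lookup_add lookup_single when_def split: if_splits)
  show "eval_fewnomial f v = x * mono_val a v + y * mono_val b v + z * mono_val c v"
    unfolding eval_fewnomial_def k using assms(1-3) l by (simp add: add.assoc)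
qed

text \<open>
An example of Dickenstein, Rojas, Rusek and Shih, who lowered the degree of Haas' original one
from \<open>108\<close> to \<open>6\<close>.
\<close>

definition five_root_system :: "2 \<Rightarrow> 2 fewnomial" where
  "five_root_system i = (if i = 1
     then Poly_Mapping.single (vector [0, 1]) (- 1) + Poly_Mapping.single (vector [6, 0]) 1
       + Poly_Mapping.single (vector [0, 3]) (44 / 31)
     else Poly_Mapping.single (vector [1, 0]) (- 1) + Poly_Mapping.single (vector [0, 6]) 1
       + Poly_Mapping.single (vector [3, 0]) (44 / 31))"

lemma five_root_system_keys:
  "Poly_Mapping.keys (five_root_system 1) = {vector [0, 1], vector [6, 0], vector [0, 3]}"
  "Poly_Mapping.lookup (five_root_system 1) (vector [0, 1]) = - 1"
  "Poly_Mapping.lookup (five_root_system 1) (vector [6, 0]) = 1"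
  "Poly_Mapping.lookup (five_root_system 1) (vector [0, 3]) = 44 / 31"
  "Poly_Mapping.keys (five_root_system 2) = {vector [1, 0], vector [0, 6], vector [3, 0]}"
  unfolding five_root_system_def
  by (simp_all add: three_term_fewnomial vec_eq_iff forall_2)

lemma five_root_system_card: "card (Poly_Mapping.keys (five_root_system i)) = 3"
  using exhaust_2[of i] by (auto simp: five_root_system_keys vec_eq_iff forall_2)

lemma eval_five_root_system:
  assumes "0 < x" "0 < y"
  shows "eval_fewnomial (five_root_system 1) (vector [x, y]) = x ^ 6 + 44 / 31 * y ^ 3 - y"
    "eval_fewnomial (five_root_system 2) (vector [x, y]) = y ^ 6 + 44 / 31 * x ^ 3 - x"
  using assms unfolding five_root_system_def
  by (simp_all add: three_term_fewnomial(5) vec_eq_iff forall_2 mono_val_def UNIV_2 powr_numeral)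

text \<open>
The first equation solved for \<open>x\<close>.
\<close>

definition curve_x :: "real \<Rightarrow> real" where
  "curve_x y = root 6 (y - 44 / 31 * y ^ 3)"

definition residual :: "real \<Rightarrow> real" where
  "residual y = y ^ 6 + 44 / 31 * curve_x y ^ 3 - curve_x y"

text \<open>
Rational bounds for the sixth root are verified by comparing sixth powers.
\<close>

lemma curve_x_bounds:
  assumes "0 \<le> lo" "0 \<le> hi" "lo ^ 6 < y - 44 / 31 * y ^ 3" "y - 44 / 31 * y ^ 3 < hi ^ 6"
  shows "lo < curve_x y" "curve_x y < hi"
proof -
  have "0 \<le> lo ^ 6" using assms(1) by simp
  then have w: "0 \<le> y - 44 / 31 * y ^ 3" using assms(3) by linarith
  then have x: "curve_x y ^ 6 = y - 44 / 31 * y ^ 3" "0 \<le> curve_x y" by (simp_all add: curve_x_def)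
  show "lo < curve_x y" by (rule power_less_imp_less_base[of _ 6]) (use assms x in auto)
  show "curve_x y < hi" by (rule power_less_imp_less_base[of _ 6]) (use assms x in auto)
qed

lemma residual_pos:
  assumes "0 \<le> lo" "0 \<le> hi" "lo ^ 6 < y - 44 / 31 * y ^ 3" "y - 44 / 31 * y ^ 3 < hi ^ 6"
    and "0 < y ^ 6 + 44 / 31 * lo ^ 3 - hi"
  shows "residual y > 0"
proof -
  have "lo ^ 3 \<le> curve_x y ^ 3" using curve_x_bounds[OF assms(1-4)] assms(1) by (intro power_mono) auto
  then show ?thesis using curve_x_bounds[OF assms(1-4)] assms(5) unfolding residual_def by linarith
qed

lemma residual_neg:
  assumes "0 \<le> lo" "0 \<le> hi" "lo ^ 6 < y - 44 / 31 * y ^ 3" "y - 44 / 31 * y ^ 3 < hi ^ 6"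
    and "y ^ 6 + 44 / 31 * hi ^ 3 - lo < 0"
  shows "residual y < 0"
proof -
  have "curve_x y ^ 3 \<le> hi ^ 3" using curve_x_bounds[OF assms(1-4)] assms(1) by (intro power_mono) auto
  then show ?thesis using curve_x_bounds[OF assms(1-4)] assms(5) unfolding residual_def by linarith
qed

text \<open>
The extreme values of the residual next to the middle root, which lies on the diagonal \<open>x = y\<close>, are
only about \<open>5 \<times> 10\<^sup>-\<^sup>6\<close>; this is why six digits of the sixth root are used at \<open>73/100\<close> and \<open>3/4\<close>.
\<close>

lemma residual_sign_changes:
  "residual (1/2) < 0" "residual (63/100) > 0" "residual (73/100) < 0"
  "residual (3/4) > 0" "residual (4/5) < 0" "residual (83/100) > 0"
proof -
  show "residual (1/2) < 0"
    by (rule residual_neg[of "207/250" "829/1000"]) (simp_all add: power_divide)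
  show "residual (63/100) > 0"
    by (rule residual_pos[of "504/625" "1613/2000"]) (simp_all add: power_divide)
  show "residual (73/100) < 0"
    by (rule residual_neg[of "749907/1000000" "187477/250000"]) (simp_all add: power_divide)
  show "residual (3/4) > 0"
    by (rule residual_pos[of "729899/1000000" "7299/10000"]) (simp_all add: power_divide)
  show "residual (4/5) < 0"
    by (rule residual_neg[of "6469/10000" "647/1000"]) (simp_all add: power_divide)
  show "residual (83/100) > 0"
    by (rule residual_pos[of "513/1000" "257/500"]) (simp_all add: power_divide)
qed

lemma curve_x_pos:
  assumes "1/2 \<le> y" "y \<le> 83/100"
  shows "0 < y - 44 / 31 * y ^ 3" "0 < curve_x y"
proof -
  have "y * y \<le> 83/100 * (83/100)" using assms by (intro mult_mono) auto
  then have "0 < y * (1 - 44 / 31 * (y * y))" using assms by (intro mult_pos_pos) auto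
  then show "0 < y - 44 / 31 * y ^ 3" by (simp add: power3_eq_cube algebra_simps)
  then show "0 < curve_x y" by (simp add: curve_x_def)
qed

lemma residual_five_zeros:
  obtains y1 y2 y3 y4 y5 where "1/2 < y1" "y1 < y2" "y2 < y3" "y3 < y4" "y4 < y5" "y5 < 83/100"
    "residual y1 = 0" "residual y2 = 0" "residual y3 = 0"
    "residual y4 = 0" "residual y5 = 0"
proof -
  have cont: "continuous_on S residual" for S
    unfolding residual_def[abs_def] curve_x_def by (intro continuous_intros)
  have ivt: "\<exists>y. p < y \<and> y < q \<and> residual y = 0"
    if "p < q" "residual p < 0 \<and> residual q > 0 \<or> residual p > 0 \<and> residual q < 0" for p q
  proof -
    have "\<exists>y\<ge>p. y \<le> q \<and> residual y = 0"
      using that(2)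
    proof
      assume "residual p < 0 \<and> residual q > 0"
      then show ?thesis using that(1) cont by (intro IVT') auto
    next
      assume "residual p > 0 \<and> residual q < 0"
      then show ?thesis using that(1) cont by (intro IVT2') auto
    qed
    then obtain y where y: "p \<le> y" "y \<le> q" "residual y = 0" by blast
    then have "y \<noteq> p" "y \<noteq> q" using that by auto
    then show ?thesis using y by (intro exI[of _ y]) auto
  qed
  obtain y1 where "1/2 < y1" "y1 < 63/100" "residual y1 = 0" using ivt[of "1/2" "63/100"] residual_sign_changes by auto
  moreover obtain y2 where "63/100 < y2" "y2 < 73/100" "residual y2 = 0" using ivt[of "63/100" "73/100"] residual_sign_changes by auto
  moreover obtain y3 where "73/100 < y3" "y3 < 3/4" "residual y3 = 0" using ivt[of "73/100" "3/4"] residual_sign_changes by auto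
  moreover obtain y4 where "3/4 < y4" "y4 < 4/5" "residual y4 = 0" using ivt[of "3/4" "4/5"] residual_sign_changes by auto
  moreover obtain y5 where "4/5 < y5" "y5 < 83/100" "residual y5 = 0" using ivt[of "4/5" "83/100"] residual_sign_changes by auto
  ultimately show thesis using that[of y1 y2 y3 y4 y5] by linarith
qed

lemma point_over:
  assumes "1/2 \<le> y" "y \<le> 83/100"
  shows "vector [curve_x y, y] \<in> (pos_orthant :: (real ^ 2) set)" "eval_fewnomial (five_root_system 1) (vector [curve_x y, y]) = 0"
    "eval_fewnomial (five_root_system 2) (vector [curve_x y, y]) = residual y"
proof -
  have y: "0 < y" using assms by simp
  note pos = curve_x_pos[OF assms]
  show "vector [curve_x y, y] \<in> (pos_orthant :: (real ^ 2) set)"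
    using y pos(2) by (simp add: pos_orthant_def forall_2)
  have "curve_x y ^ 6 = y - 44 / 31 * y ^ 3" using pos(1) unfolding curve_x_def by simp
  then show "eval_fewnomial (five_root_system 1) (vector [curve_x y, y]) = 0"
    unfolding eval_five_root_system(1)[OF pos(2) y] by simp
  show "eval_fewnomial (five_root_system 2) (vector [curve_x y, y]) = residual y"
    unfolding eval_five_root_system(2)[OF pos(2) y] residual_def ..
qed

text \<open>
The residual has five zeros, but does not vanish at \<open>y = 1/2\<close>; so the second equation does not
vanish along the whole curve, there are finitely many roots, and they are isolated.
\<close>

lemma five_isolated_roots: "finite {z. isolated_root five_root_system z}" "5 \<le> card {z. isolated_root five_root_system z}"
proof -
  show fin: "finite {z. isolated_root five_root_system z}"
    using isolated_bound[of five_root_system 3] five_root_system_card by auto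
  have "det2 (vector [6, 0] - vector [0, 1]) (vector [0, 3] - vector [0, 1]) \<noteq> 0"
    by (simp add: det2_def)
  then obtain e1 e2 where n: "normal_trinomial (five_root_system 1) (vector [0, 1]) (vector [6, 0]) (vector [0, 3]) e1 e2"
    using normal_trinomialI[OF five_root_system_keys(1)] five_root_system_keys by auto
  let ?r = "normal_trinomial.restr (five_root_system 1) (vector [0, 1]) (vector [6, 0]) (vector [0, 3]) e1 e2 (five_root_system 2)"
  have fz: "fewer_zeros ?r {0<..<1} 6"
    using normal_trinomial_fewer_zeros[OF n, of "five_root_system 2" 3] five_root_system_card by simp
  have "\<not> (\<forall>u\<in>{0<..<1}. ?r u = 0)"
  proof
    assume all: "\<forall>u\<in>{0<..<1}. ?r u = 0"
    have "vector [curve_x (1/2), 1/2] \<in> (pos_orthant :: (real ^ 2) set)" by (rule point_over) simp_all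
    then obtain w :: "real ^ 2" where w: "vector [curve_x (1/2), 1/2] = expv w" by (rule pos_orthant_expv)
    have "eval_fewnomial (five_root_system 1) (expv w) = 0" "eval_fewnomial (five_root_system 2) (expv w) < 0"
      using point_over[of "1/2"] residual_sign_changes(1) unfolding w[symmetric] by auto
    moreover obtain u where "u \<in> {0<..<1}" "w = normal_trinomial.log_curve (five_root_system 1) (vector [0, 1])
        (vector [6, 0]) (vector [0, 3]) e1 e2 u"
      using calculation(1) normal_trinomial.zero_set_is_curve[OF n] by blast
    ultimately show False
      using normal_trinomial.eval_on_curve[OF n, of u "five_root_system 2"] all by simp
  qed
  then have "finite {u\<in>{0<..<1}. ?r u = 0}" using fz unfolding fewer_zeros_def by blast
  then have "finite (pos_roots five_root_system)"
    unfolding normal_trinomial.pos_roots_on_curve[OF n, of five_root_system, OF refl] by simp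
  then have iso: "isolated_root five_root_system z" if "z \<in> pos_roots five_root_system" for z
    using isolated_root_if_not_limit_point[OF that] islimpt_finite by blast
  obtain y1 y2 y3 y4 y5 where y: "1/2 < y1" "y1 < y2" "y2 < y3" "y3 < y4" "y4 < y5" "y5 < 83/100"
    "residual y1 = 0" "residual y2 = 0" "residual y3 = 0"
    "residual y4 = 0" "residual y5 = 0"
    using residual_five_zeros .
  let ?Y = "{y1, y2, y3, y4, y5}"
  have "(\<lambda>y. vector [curve_x y, y]) ` ?Y \<subseteq> {z. isolated_root five_root_system z}"
  proof -
    have "vector [curve_x v, v] \<in> {z. isolated_root five_root_system z}" if "v \<in> ?Y" for v
    proof -
      have "1/2 \<le> v" "v \<le> 83/100" "residual v = 0" using that y by auto
      then show ?thesis using point_over[of v] iso by (simp add: pos_roots_2)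
    qed
    then show ?thesis by blast
  qed
  moreover have "inj_on (\<lambda>y. vector [curve_x y, y] :: real ^ 2) ?Y"
    by (auto simp: inj_on_def vec_eq_iff forall_2)
  moreover have "card ?Y = 5" using y by simp
  ultimately show "5 \<le> card {z. isolated_root five_root_system z}"
    using card_mono[OF fin, of "(\<lambda>y. vector [curve_x y, y]) ` ?Y"] by (simp only: card_image)
qed

section \<open>The maximal numbers of roots\<close>

lemma has_type_2:
  fixes F :: "2 \<Rightarrow> 2 fewnomial"
  assumes "3 \<le> m"
  shows "has_type F (vector [3, m]) \<longleftrightarrow>
    card (Poly_Mapping.keys (F 1)) = 3 \<and> card (Poly_Mapping.keys (F 2)) = m"
  using assms by (auto simp: has_type_def forall_2 is_nomial_def)

lemma max_isolated_le:
  assumes "3 \<le> m"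
  shows "max_isolated (vector [3, m] :: nat ^ 2) \<le> enat (if m = 3 then 5 else 2 ^ m - 2)"
  unfolding max_isolated_def
proof (rule SUP_least)
  fix F :: "2 \<Rightarrow> 2 fewnomial" assume "F \<in> {F. has_type F (vector [3, m])}"
  then show "num_elems {z. isolated_root F z} \<le> enat (if m = 3 then 5 else 2 ^ m - 2)"
    using isolated_bound[of F m] assms by (simp add: has_type_2 num_elems_def)
qed

lemma num_elems_ge_card:
  assumes "finite Y" "Y \<subseteq> S"
  shows "enat (card Y) \<le> num_elems S"
  using assms card_mono by (auto simp: num_elems_def)

lemma num_elems_mono: "S \<subseteq> T \<Longrightarrow> num_elems S \<le> num_elems T"
  by (auto simp: num_elems_def card_mono dest: finite_subset)

lemma max_isolated_3_3: "max_isolated (vector [3, 3] :: nat ^ 2) = 5"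
proof (rule antisym)
  show "max_isolated (vector [3, 3] :: nat ^ 2) \<le> 5"
    using max_isolated_le[of 3] by (simp add: numeral_eq_enat)
  have "five_root_system \<in> {F. has_type F (vector [3, 3])}" by (simp add: has_type_2 five_root_system_card)
  then have "num_elems {z. isolated_root five_root_system z} \<le> max_isolated (vector [3, 3] :: nat ^ 2)"
    unfolding max_isolated_def by (rule SUP_upper)
  moreover have "5 \<le> num_elems {z. isolated_root five_root_system z}"
    using five_isolated_roots by (simp add: num_elems_def numeral_eq_enat)
  ultimately show "5 \<le> max_isolated (vector [3, 3] :: nat ^ 2)" by (rule order_trans[rotated])
qed

text \<open>
Both suprema run over the same systems, and each system is dominated by one with sufficiently many
nondegenerate roots.
\<close>

lemma max_nondegenerate_eq_max_isolated:
  assumes "3 \<le> m"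
  shows "max_nondegenerate (vector [3, m] :: nat ^ 2) = max_isolated (vector [3, m] :: nat ^ 2)"
proof (rule antisym)
  show "max_nondegenerate (vector [3, m] :: nat ^ 2) \<le> max_isolated (vector [3, m] :: nat ^ 2)"
    unfolding max_nondegenerate_def max_isolated_def
    by (rule SUP_subset_mono[OF order_refl], rule num_elems_mono)
      (auto intro: nondegenerate_imp_isolated)
  show "max_isolated (vector [3, m] :: nat ^ 2) \<le> max_nondegenerate (vector [3, m] :: nat ^ 2)"
    unfolding max_isolated_def
  proof (rule SUP_least)
    fix F :: "2 \<Rightarrow> 2 fewnomial" assume "F \<in> {F. has_type F (vector [3, m])}"
    then have F: "card (Poly_Mapping.keys (F 1)) = 3" "card (Poly_Mapping.keys (F 2)) = m"
      using assms by (auto simp: has_type_2)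
    obtain G :: "2 \<Rightarrow> 2 fewnomial" and Y where G: "card (Poly_Mapping.keys (G 1)) = 3"
      "card (Poly_Mapping.keys (G 2)) = m" and Y: "finite Y" "card {z. isolated_root F z} \<le> card Y"
      "Y \<subseteq> {z. nondegenerate_root G z}"
      using nondegenerate_at_least_isolated[OF F assms] by blast
    have "num_elems {z. isolated_root F z} = enat (card {z. isolated_root F z})"
      using isolated_bound[OF F assms] by (simp add: num_elems_def)
    also have "\<dots> \<le> enat (card Y)" using Y(2) by simp
    also have "\<dots> \<le> num_elems {z. nondegenerate_root G z}" using Y by (intro num_elems_ge_card)
    also have "\<dots> \<le> max_nondegenerate (vector [3, m] :: nat ^ 2)"
      unfolding max_nondegenerate_def by (rule SUP_upper) (use G assms in \<open>simp add: has_type_2\<close>)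
    finally show "num_elems {z. isolated_root F z} \<le> max_nondegenerate (vector [3, m] :: nat ^ 2)" .
  qed
qed

theorem theorem1:
  shows "(\<forall>m::nat. 3 \<le> m \<longrightarrow> max_isolated (vector [3, m] :: nat ^ 2) \<le> enat (2 ^ m - 2)) \<and>
    max_isolated (vector [3, 3] :: nat ^ 2) = 5 \<and>
    max_isolated (vector [3, 4] :: nat ^ 2) \<le> 14 \<and>
    max_isolated (vector [3, 5] :: nat ^ 2) \<le> 30 \<and>
    (\<forall>m::nat. 3 \<le> m \<longrightarrow>
      max_nondegenerate (vector [3, m] :: nat ^ 2) = max_isolated (vector [3, m] :: nat ^ 2))"
proof (intro conjI allI impI)
  fix m :: nat assume m: "3 \<le> m"
  have "enat (if m = 3 then 5 else 2 ^ m - 2) \<le> enat (2 ^ m - 2)" by simp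
  then show "max_isolated (vector [3, m] :: nat ^ 2) \<le> enat (2 ^ m - 2)"
    using max_isolated_le[OF m] by (rule order_trans[rotated])
  show "max_nondegenerate (vector [3, m] :: nat ^ 2) = max_isolated (vector [3, m] :: nat ^ 2)"
    by (rule max_nondegenerate_eq_max_isolated[OF m])
next
  show "max_isolated (vector [3, 3] :: nat ^ 2) = 5" by (rule max_isolated_3_3)
  show "max_isolated (vector [3, 4] :: nat ^ 2) \<le> 14"
    using max_isolated_le[of 4] by (simp add: numeral_eq_enat)
  show "max_isolated (vector [3, 5] :: nat ^ 2) \<le> 30"
    using max_isolated_le[of 5] by (simp add: numeral_eq_enat)
qed

end
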